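(* Let $\alpha$ and $\beta$ be two finite Blaschke products of degree $m>0$ and $n>0$, respectively. The only rank-one operators in $\mathscr{T}(\alpha,\beta)$ are the nonzero scalar multiples of the operators $\widetilde{k}_w^{\beta}\otimes k_w^{\alpha}$ and $k_w^{\beta}\otimes\widetilde{k}_w^{\alpha}$, $w\in\overline{\mathbb{D}}$, if and only if either $mn\le 2$, or $m>1$ and $n>1$.
   Context: $H^2$ is the Hardy space of the unit disk $\mathbb{D}$, viewed as a closed subspace of $L^2(\partial\mathbb{D})$ with its usual inner product $\langle\cdot,\cdot\rangle$ (normalized Lebesgue measure, linear in the first argument). For a finite Blaschke product $\alpha$, the model space is $K_\alpha=H^2\ominus\alpha H^2$; its dimension is the degree of $\alpha$ and all its functions are bounded. $P_\alpha$ denotes the orthogonal projection from $L^2(\partial\mathbb{D})$ onto $K_\alpha$. For $\varphi\in L^2(\partial\mathbb{D})$ the asymmetric truncated Toeplitz operator $A_\varphi^{\alpha,\beta}:K_\alpha\to K_\beta$ is $A_\varphi^{\alpha,\beta}f=P_\beta(\varphi f)$, and $\mathscr{T}(\alpha,\beta)$ is the set of all bounded $A_\varphi^{\alpha,\beta}$, $\varphi\in L^2(\partial\mathbb{D})$ (boundedness is automatic here since the spaces are finite-dimensional). For $w\in\overline{\mathbb{D}}$ the reproducing kernel and the conjugate kernel are the functions in $K_\alpha$ given by $$k_w^\alpha(z)=\frac{1-\overline{\alpha(w)}\alpha(z)}{1-\overline{w}z},\qquad \widetilde{k}_w^\alpha(z)=\frac{\alpha(z)-\alpha(w)}{z-w}$$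 (with removable singularities removed; $\alpha$ is analytic on a neighbourhood of $\overline{\mathbb{D}}$, so these make sense also for $|w|=1$). The same notation is used with $\beta$ in place of $\alpha$. For vectors $f,g$, $f\otimes g$ is the operator $(f\otimes g)h=\langle h,g\rangle f$. *)

theory Defs
  imports "HOL-Analysis.Analysis"
begin

section \<open>The space $L^2$ of the unit circle\<close>

definition circle_measure :: "complex measure" where
  "circle_measure = distr (uniform_measure lborel {0..<2 * pi}) borel cis"

definition square_integrable :: "(complex \<Rightarrow> complex) \<Rightarrow> bool" where
  "square_integrable f \<longleftrightarrow>
     f \<in> borel_measurable circle_measure \<and> integrable circle_measure (\<lambda>z. (norm (f z))\<^sup>2)"

lemma square_integrable_zero: "square_integrable (\<lambda>z. 0)"
  by (simp add: square_integrable_def)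

lemma square_integrable_add:
  assumes "square_integrable f" "square_integrable g"
  shows "square_integrable (\<lambda>z. f z + g z)"
proof -
  have [measurable]: "f \<in> borel_measurable circle_measure" "g \<in> borel_measurable circle_measure"
    using assms by (auto simp: square_integrable_def)
  have i: "integrable circle_measure (\<lambda>z. 2 * (norm (f z))\<^sup>2 + 2 * (norm (g z))\<^sup>2)"
    using assms by (auto simp: square_integrable_def)
  have "integrable circle_measure (\<lambda>z. (norm (f z + g z))\<^sup>2)"
  proof (rule Bochner_Integration.integrable_bound[OF i])
    have "(norm (f z + g z))\<^sup>2 \<le> 2 * (norm (f z))\<^sup>2 + 2 * (norm (g z))\<^sup>2" for z
    proof -
      have "(norm (f z + g z))\<^sup>2 \<le> (norm (f z) + norm (g z))\<^sup>2"
        by (intro power_mono norm_triangle_ineq) auto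
      moreover have "0 \<le> (norm (f z) - norm (g z))\<^sup>2" by simp
      ultimately show ?thesis by (simp add: power2_eq_square algebra_simps)
    qed
    then show "AE z in circle_measure. norm ((norm (f z + g z))\<^sup>2)
        \<le> norm (2 * (norm (f z))\<^sup>2 + 2 * (norm (g z))\<^sup>2)"
      by (intro AE_I2) (auto intro: order_trans[OF _ abs_ge_self])
  qed measurable
  then show ?thesis by (auto simp: square_integrable_def)
qed

lemma square_integrable_scale:
  assumes "square_integrable f"
  shows "square_integrable (\<lambda>z. c * f z)"
  using assms by (auto simp: square_integrable_def norm_mult power_mult_distrib)

definition L2_rel :: "(complex \<Rightarrow> complex) \<Rightarrow> (complex \<Rightarrow> complex) \<Rightarrow> bool" where
  "L2_rel f g \<longleftrightarrow>
     square_integrable f \<and> square_integrable g \<and> (AE z in circle_measure. f z = g z)"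

quotient_type L2 = "complex \<Rightarrow> complex" / partial: L2_rel
proof (rule part_equivpI)
  show "\<exists>f. L2_rel f f"
    by (rule exI[of _ "\<lambda>z. 0"]) (simp add: L2_rel_def square_integrable_zero)
  show "symp L2_rel"
    by (rule sympI) (auto simp: L2_rel_def)
  show "transp L2_rel"
    by (rule transpI) (auto simp: L2_rel_def)
qed

instantiation L2 :: ab_group_add
begin

lift_definition zero_L2 :: L2 is "\<lambda>z. 0"
  by (simp add: L2_rel_def square_integrable_zero)

lift_definition plus_L2 :: "L2 \<Rightarrow> L2 \<Rightarrow> L2" is "\<lambda>f g z. f z + g z"
  by (auto simp: L2_rel_def square_integrable_add)

lift_definition uminus_L2 :: "L2 \<Rightarrow> L2" is "\<lambda>f z. - f z"
  using square_integrable_scale[of _ "-1"] by (auto simp: L2_rel_def)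

definition minus_L2 :: "L2 \<Rightarrow> L2 \<Rightarrow> L2" where
  "f - g = f + (- g)" for f g :: L2

instance
proof
  fix a b c :: L2
  show "a + b + c = a + (b + c)"
    by transfer (auto simp: L2_rel_def add.assoc intro!: square_integrable_add)
  show "a + b = b + a"
    by transfer (auto simp: L2_rel_def add.commute intro!: square_integrable_add)
  show "0 + a = a"
    by transfer (auto simp: L2_rel_def)
  show "- a + a = 0"
    by transfer (auto simp: L2_rel_def square_integrable_zero)
  show "a - b = a + - b"
    by (rule minus_L2_def)
qed

end

lift_definition scale_L2 :: "complex \<Rightarrow> L2 \<Rightarrow> L2" (infixr \<open>*\<^sub>L\<close> 75) is "\<lambda>c f z. c * f z"
  by (auto simp: L2_rel_def square_integrable_scale)

interpretation L2: vector_space scale_L2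
proof
  fix a b :: complex and x y :: L2
  show "a *\<^sub>L (x + y) = a *\<^sub>L x + a *\<^sub>L y"
    by transfer (auto simp: L2_rel_def algebra_simps
        intro!: square_integrable_add square_integrable_scale)
  show "(a + b) *\<^sub>L x = a *\<^sub>L x + b *\<^sub>L x"
    by transfer (auto simp: L2_rel_def algebra_simps
        intro!: square_integrable_add square_integrable_scale)
  show "a *\<^sub>L b *\<^sub>L x = (a * b) *\<^sub>L x"
    by transfer (auto simp: L2_rel_def mult.assoc intro!: square_integrable_scale)
  show "1 *\<^sub>L x = x"
    by transfer (auto simp: L2_rel_def)
qed

lemma cnj_borel_measurable [measurable]: "cnj \<in> borel_measurable borel"
  by (intro borel_measurable_continuous_onI continuous_intros)

lift_definition inner_L2 :: "L2 \<Rightarrow> L2 \<Rightarrow> complex"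
  is "\<lambda>f g. \<integral>z. f z * cnj (g z) \<partial>circle_measure"
proof -
  fix f f' g g' :: "complex \<Rightarrow> complex"
  assume r: "L2_rel f f'" "L2_rel g g'"
  have [measurable]: "f \<in> borel_measurable circle_measure" "f' \<in> borel_measurable circle_measure"
      "g \<in> borel_measurable circle_measure" "g' \<in> borel_measurable circle_measure"
    using r by (auto simp: L2_rel_def square_integrable_def)
  have "AE z in circle_measure. f z = f' z" "AE z in circle_measure. g z = g' z"
    using r by (auto simp: L2_rel_def)
  then have "AE z in circle_measure. f z * cnj (g z) = f' z * cnj (g' z)"
    by eventually_elim simp
  then show "(\<integral>z. f z * cnj (g z) \<partial>circle_measure) = (\<integral>z. f' z * cnj (g' z) \<partial>circle_measure)"
    by (intro integral_cong_AE) measurable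
qed

definition norm_L2 :: "L2 \<Rightarrow> real" where
  "norm_L2 f = sqrt (Re (inner_L2 f f))"

text \<open>
  The product of two elements of $L^2$ need not be in $L^2$; the value in that case is the
  junk value 0. Below, at least one factor is always essentially bounded, so that the
  product is the genuine pointwise one.
\<close>

lift_definition mult_L2 :: "L2 \<Rightarrow> L2 \<Rightarrow> L2"
  is "\<lambda>f g. if square_integrable (\<lambda>z. f z * g z) then (\<lambda>z. f z * g z) else (\<lambda>z. 0)"
proof -
  fix f f' g g' :: "complex \<Rightarrow> complex"
  assume r: "L2_rel f f'" "L2_rel g g'"
  have [measurable]: "f \<in> borel_measurable circle_measure" "f' \<in> borel_measurable circle_measure"
      "g \<in> borel_measurable circle_measure" "g' \<in> borel_measurable circle_measure"
    using r by (auto simp: L2_rel_def square_integrable_def)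
  have "AE z in circle_measure. f z = f' z" "AE z in circle_measure. g z = g' z"
    using r by (auto simp: L2_rel_def)
  then have ae: "AE z in circle_measure. f z * g z = f' z * g' z"
    by eventually_elim simp
  then have "AE z in circle_measure. (norm (f z * g z))\<^sup>2 = (norm (f' z * g' z))\<^sup>2"
    by eventually_elim simp
  then have "integrable circle_measure (\<lambda>z. (norm (f z * g z))\<^sup>2)
      \<longleftrightarrow> integrable circle_measure (\<lambda>z. (norm (f' z * g' z))\<^sup>2)"
    by (intro integrable_cong_AE) measurable
  then have "square_integrable (\<lambda>z. f z * g z) \<longleftrightarrow> square_integrable (\<lambda>z. f' z * g' z)"
    by (simp add: square_integrable_def)
  with ae show "L2_rel (if square_integrable (\<lambda>z. f z * g z) then (\<lambda>z. f z * g z) else (\<lambda>z. 0))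
      (if square_integrable (\<lambda>z. f' z * g' z) then (\<lambda>z. f' z * g' z) else (\<lambda>z. 0))"
    by (auto simp: L2_rel_def square_integrable_zero)
qed

text \<open>The orthogonal projection onto a closed subspace (for other sets the value is unspecified).\<close>

definition orth_proj :: "L2 set \<Rightarrow> L2 \<Rightarrow> L2" where
  "orth_proj K f = (THE h. h \<in> K \<and> (\<forall>g\<in>K. inner_L2 (f - h) g = 0))"

section \<open>Hardy space, finite Blaschke products, model spaces\<close>

text \<open>As a subspace of $L^2$ of the circle, $H^2$ consists of the functions whose Fourier
  coefficients of negative index vanish.\<close>

definition H2 :: "L2 set" where
  "H2 = {f. \<forall>k::int. k < 0 \<longrightarrow> inner_L2 f (abs_L2 (\<lambda>z. z powi k)) = 0}"

definition finite_Blaschke :: "(complex \<Rightarrow> complex) \<Rightarrow> nat \<Rightarrow> bool" where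
  "finite_Blaschke \<alpha> m \<longleftrightarrow>
     (\<exists>c a. norm c = 1 \<and> (\<forall>i<m. norm (a i) < 1) \<and>
        \<alpha> = (\<lambda>z. c * (\<Prod>i<m. (z - a i) / (1 - cnj (a i) * z))))"

definition model_space :: "(complex \<Rightarrow> complex) \<Rightarrow> L2 set" where
  "model_space \<alpha> = {f \<in> H2. \<forall>h\<in>H2. inner_L2 f (mult_L2 (abs_L2 \<alpha>) h) = 0}"

text \<open>
  The kernels enter only as elements of $L^2$ of the circle. For $|w| < 1$ neither
  denominator vanishes on the circle; for $|w| = 1$ the only removable singularity on the
  circle is at $z = w$, a null set, so the value of the quotient there is irrelevant.
\<close>

definition repr_kernel :: "(complex \<Rightarrow> complex) \<Rightarrow> complex \<Rightarrow> L2" where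
  "repr_kernel \<alpha> w = abs_L2 (\<lambda>z. (1 - cnj (\<alpha> w) * \<alpha> z) / (1 - cnj w * z))"

definition conj_kernel :: "(complex \<Rightarrow> complex) \<Rightarrow> complex \<Rightarrow> L2" where
  "conj_kernel \<alpha> w = abs_L2 (\<lambda>z. (\<alpha> z - \<alpha> w) / (z - w))"

section \<open>Asymmetric truncated Toeplitz operators\<close>

text \<open>
  An operator with domain \<open>K\<close> is represented by a function that is \<open>undefined\<close>
  outside \<open>K\<close>, so that equality of operators is equality of functions.
\<close>

definition attoeplitz :: "(complex \<Rightarrow> complex) \<Rightarrow> (complex \<Rightarrow> complex) \<Rightarrow> L2 \<Rightarrow> L2 \<Rightarrow> L2" where
  "attoeplitz \<alpha> \<beta> \<phi> = (\<lambda>f\<in>model_space \<alpha>. orth_proj (model_space \<beta>) (mult_L2 \<phi> f))"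

definition bounded_on :: "L2 set \<Rightarrow> (L2 \<Rightarrow> L2) \<Rightarrow> bool" where
  "bounded_on K A \<longleftrightarrow> (\<exists>C. \<forall>f\<in>K. norm_L2 (A f) \<le> C * norm_L2 f)"

definition attoeplitz_ops :: "(complex \<Rightarrow> complex) \<Rightarrow> (complex \<Rightarrow> complex) \<Rightarrow> (L2 \<Rightarrow> L2) set" where
  "attoeplitz_ops \<alpha> \<beta> =
     {attoeplitz \<alpha> \<beta> \<phi> | \<phi>. bounded_on (model_space \<alpha>) (attoeplitz \<alpha> \<beta> \<phi>)}"

definition rank_on :: "L2 set \<Rightarrow> (L2 \<Rightarrow> L2) \<Rightarrow> nat" where
  "rank_on K A = L2.dim (A ` K)"

definition tensor :: "L2 \<Rightarrow> L2 \<Rightarrow> L2 \<Rightarrow> L2" (infix \<open>\<otimes>\<^sub>L\<close> 70) where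
  "(f \<otimes>\<^sub>L g) h = inner_L2 h g *\<^sub>L f"

definition scaled_op_on :: "L2 set \<Rightarrow> complex \<Rightarrow> (L2 \<Rightarrow> L2) \<Rightarrow> L2 \<Rightarrow> L2" where
  "scaled_op_on K c A = (\<lambda>h\<in>K. c *\<^sub>L A h)"

end

theory Submission
  imports Defs
begin

text \<open>
  Write $\alpha = c P / q$ with $q(z) = \prod (1 - \overline{a_i} z)$. The model space $K_\alpha$ has
  the basis $e_i = z^i / q$, $0 \le i < m$ (\<open>model_space_eq_span\<close>); let $f_l$, $0 \le l < n$,
  be the corresponding basis of $K_\beta$. Since $\overline{z} = 1/z$ on the circle, the number
  $\langle \varphi e_i, f_l \rangle$ depends on $i - l$ only. After reversing the order of the second
  basis, $A_\varphi$ is therefore encoded by an $m \times n$ Hankel matrix $h(i + j)$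
  (\<open>attoeplitz_Hankel\<close>). Conversely every $h$ occurs: take for $\varphi$ a Laurent polynomial times
  $q_\alpha \overline{q_\beta}$, which cancels the denominators (\<open>attoeplitz_Hankel_exists\<close>). So the
  theorem is a statement about Hankel matrices of rank one.

  Both kinds of kernels $k$ satisfy an equation $(s z + t) k = u \alpha + v$ with constants
  $s, t, u, v$. For $0 < i < m$ the functions $\alpha$ and $1$ are orthogonal to $e_i$, so pairing the
  equation with $e_i$ gives
  $s \langle k, e_{i-1} \rangle + t \langle k, e_i \rangle = 0$ (\<open>inner_E_recurrence\<close>): the
  coefficients of a kernel form a geometric progression. This covers $|w| < 1$ and $|w| = 1$ at once.
  Up to nonzero factors, $\widetilde{k}_w^\beta \otimes k_w^\alpha$ thus has the matrix $w^{i+j}$, and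
  $k_w^\beta \otimes \widetilde{k}_w^\alpha$ has the matrix $\overline{w}^{(m-1-i)+(n-1-j)}$. In
  particular both are operators of rank one in $\mathscr{T}(\alpha, \beta)$ for all degrees.

  A Hankel matrix of rank one is $x_i y_j$ with $x_{i+1} y_j = x_i y_{j+1}$. If $m, n > 1$, both
  factors are geometric with a common ratio, which is a point $w$ of the Riemann sphere; the same is
  trivially true if $m n \le 2$ (\<open>rank_one_Hankel\<close>). The points with $|w| \le 1$ give the first
  family and those with $|w| > 1$, including $\infty$, give the second one with parameter
  $1/\overline{w}$. If one of the degrees is $1$ and the other exceeds $2$, every nonzero row is a
  Hankel matrix of rank one, and $(1, 0, 1, 0, \dots)$ is not geometric
  (\<open>exists_rank_one_not_kernel_tensor\<close>).
\<close>

section \<open>Normalized Lebesgue measure on the circle\<close>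

lemma emeasure_period: "emeasure lborel {0..<2 * pi} = ennreal (2 * pi)"
  by simp

lemma cis_measurable [measurable]: "cis \<in> borel_measurable borel"
  by (intro borel_measurable_continuous_onI continuous_intros)

lemma emeasure_circle_measure_UNIV: "emeasure circle_measure UNIV = 1"
  unfolding circle_measure_def
  by (subst emeasure_distr) (auto simp: emeasure_period intro!: ennreal_divide_self)

interpretation circle: finite_measure circle_measure
  by standard (simp add: circle_measure_def[THEN arg_cong[where f = space]]
      emeasure_circle_measure_UNIV)

lemma sets_circle_measure [measurable_cong, simp]: "sets circle_measure = sets borel"
  by (simp add: circle_measure_def)

lemma space_circle_measure [simp]: "space circle_measure = UNIV"
  by (simp add: circle_measure_def)

lemma AE_circle_measure_iff:
  assumes [measurable]: "Measurable.pred borel P"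
  shows "(AE z in circle_measure. P z) \<longleftrightarrow> (AE t in lborel. t \<in> {0..<2 * pi} \<longrightarrow> P (cis t))"
  unfolding circle_measure_def
  by (subst AE_distr_iff) (auto simp: AE_uniform_measure)

lemma AE_norm_eq_1: "AE z in circle_measure. norm z = 1"
  by (subst AE_circle_measure_iff) auto

text \<open>
  On the circle, the quotient defining a kernel with $|w| = 1$ has its only singularity at $w$;
  that point can be ignored.
\<close>

lemma AE_circle_neq: "AE z in circle_measure. z \<noteq> w"
proof (subst AE_circle_measure_iff)
  have "countable {t. cis t = w}"
  proof (cases "\<exists>t\<^sub>0. cis t\<^sub>0 = w")
    case True
    then obtain t\<^sub>0 where "cis t\<^sub>0 = w" ..
    then have "{t. cis t = w} \<subseteq> range (\<lambda>n::int. t\<^sub>0 + 2 * pi * n)"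
      using sin_cos_eq_iff[of _ t\<^sub>0] by (auto simp: complex_eq_iff)
    then show ?thesis
      by (rule countable_subset) auto
  qed auto
  then have "AE t in lborel. t \<notin> {t. cis t = w}"
    by (intro AE_not_in countable_imp_null_set_lborel)
  then show "AE t in lborel. t \<in> {0..<2 * pi} \<longrightarrow> cis t \<noteq> w"
    by auto
qed measurable

lemma power_int_measurable [measurable]: "(\<lambda>z::complex. z powi k) \<in> borel_measurable borel"
  unfolding power_int_def by (cases "k \<ge> 0") simp_all

text \<open>
  The integral over one period of $e^{ikt}$ is computed from the primitive $e^{ikt} / (ik)$.
\<close>

lemma integral_power_int: "(\<integral>z. z powi k \<partial>circle_measure) = (if k = 0 then 1 else 0)"
proof (cases "k = 0")
  case True
  then show ?thesis
    using emeasure_circle_measure_UNIV by (simp add: measure_def)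
next
  case False
  have "(\<integral>z. z powi k \<partial>circle_measure) = (\<integral>t. cis t powi k \<partial>uniform_measure lborel {0..<2 * pi})"
    unfolding circle_measure_def by (subst integral_distr) auto
  also have "uniform_measure lborel {0..<2 * pi} =
      density lborel (\<lambda>t. ennreal (indicator {0..<2 * pi} t / (2 * pi)))"
    unfolding uniform_measure_def emeasure_period
    by (intro density_cong) (auto simp: indicator_def divide_ennreal[symmetric] ennreal_1)
  also have "(\<integral>t. cis t powi k \<partial>\<dots>) =
      (\<integral>t. (indicator {0..<2 * pi} t / (2 * pi)) *\<^sub>R cis (k * t) \<partial>lborel)"
    by (subst integral_density) (auto simp: cis_power_int)
  also have "\<dots> = (\<integral>t. (1 / (2 * pi)) *\<^sub>R (indicator {0..2 * pi} t *\<^sub>R cis (k * t)) \<partial>lborel)"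
  proof (rule integral_cong_AE)
    have "AE t in lborel. t \<noteq> 2 * pi"
      by (rule AE_lborel_singleton)
    then show "AE t in lborel. (indicator {0..<2 * pi} t / (2 * pi)) *\<^sub>R cis (k * t) =
        (1 / (2 * pi)) *\<^sub>R (indicator {0..2 * pi} t *\<^sub>R cis (k * t))"
      by eventually_elim (auto simp: indicator_def)
  qed measurable
  also have "\<dots> = (1 / (2 * pi)) *\<^sub>R (\<integral>t. indicator {0..2 * pi} t *\<^sub>R cis (k * t) \<partial>lborel)"
    by (rule integral_scaleR_right)
  also have "(\<integral>t. indicator {0..2 * pi} t *\<^sub>R cis (k * t) \<partial>lborel) =
      cis (real_of_int k * (2 * pi)) / (\<i> * k) - cis (real_of_int k * 0) / (\<i> * k)"
  proof (rule integral_FTC_atLeastAtMost[where F = "\<lambda>t. cis (k * t) / (\<i> * k)"])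
    show "((\<lambda>t. cis (k * t) / (\<i> * k)) has_vector_derivative cis (k * t)) (at t within {0..2 * pi})"
      for t :: real
      using False unfolding has_vector_derivative_def
      by (auto intro!: derivative_eq_intros simp: scaleR_conv_of_real field_simps fun_eq_iff)
  qed (auto intro!: continuous_intros)
  also have "cis (k * (2 * pi)) = 1"
    using cos_int_2pin[of k] sin_int_2pin[of k] by (simp add: complex_eq_iff mult_ac)
  finally show ?thesis
    using False by simp
qed

section \<open>The inner product of $L^2$\<close>

lemma square_integrable_measurable [measurable_dest]:
  "square_integrable f \<Longrightarrow> f \<in> borel_measurable borel"
  unfolding square_integrable_def by (metis measurable_cong_sets sets_circle_measure)

lemma L2_rel_refl: "square_integrable f \<Longrightarrow> L2_rel f f"
  by (simp add: L2_rel_def)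

lemma abs_L2_cases:
  obtains f where "square_integrable f" "x = abs_L2 f"
  by (induct x rule: L2.abs_induct) (auto simp: L2_rel_def)

lemma abs_L2_eq_iff:
  assumes "square_integrable f" "square_integrable g"
  shows "abs_L2 f = abs_L2 g \<longleftrightarrow> (AE z in circle_measure. f z = g z)"
  using Quotient_rel[OF Quotient_L2, of f g] assms by (auto simp: L2_rel_def)

lemma abs_L2_cong_AE:
  assumes f: "f \<in> borel_measurable borel" and g: "square_integrable g"
    and AE: "AE z in circle_measure. f z = g z"
  shows "square_integrable f" "abs_L2 f = abs_L2 g"
proof -
  have [measurable]: "f \<in> borel_measurable borel" "g \<in> borel_measurable borel"
    using f g by measurable
  have "integrable circle_measure (\<lambda>z. (norm (f z))\<^sup>2) \<longleftrightarrow>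
      integrable circle_measure (\<lambda>z. (norm (g z))\<^sup>2)"
    using AE by (intro integrable_cong_AE) auto
  then show f': "square_integrable f"
    using g by (simp add: square_integrable_def)
  show "abs_L2 f = abs_L2 g"
    using AE abs_L2_eq_iff[OF f' g] by simp
qed

lemma plus_abs_L2:
  "square_integrable f \<Longrightarrow> square_integrable g \<Longrightarrow> abs_L2 f + abs_L2 g = abs_L2 (\<lambda>z. f z + g z)"
  by (simp add: plus_L2.abs_eq L2_rel_refl)

lemma scale_abs_L2: "square_integrable f \<Longrightarrow> c *\<^sub>L abs_L2 f = abs_L2 (\<lambda>z. c * f z)"
  by (simp add: scale_L2.abs_eq L2_rel_refl)

lemma inner_abs_L2:
  "square_integrable f \<Longrightarrow> square_integrable g \<Longrightarrow>
    inner_L2 (abs_L2 f) (abs_L2 g) = (\<integral>z. f z * cnj (g z) \<partial>circle_measure)"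
  by (simp add: inner_L2.abs_eq L2_rel_refl)

lemma integrable_mult_cnj:
  assumes "square_integrable f" "square_integrable g"
  shows "integrable circle_measure (\<lambda>z. f z * cnj (g z))"
proof (rule Bochner_Integration.integrable_bound)
  show "integrable circle_measure (\<lambda>z. (norm (f z))\<^sup>2 + (norm (g z))\<^sup>2)"
    using assms by (simp add: square_integrable_def)
  have "norm (f z * cnj (g z)) \<le> (norm (f z))\<^sup>2 + (norm (g z))\<^sup>2" for z
  proof -
    have "2 * (norm (f z) * norm (g z)) \<le> (norm (f z))\<^sup>2 + (norm (g z))\<^sup>2"
      using sum_squares_bound[of "norm (f z)" "norm (g z)"] by simp
    moreover have "0 \<le> norm (f z) * norm (g z)"
      by simp
    ultimately show ?thesis
      unfolding norm_mult complex_mod_cnj by linarith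
  qed
  then show "AE z in circle_measure. norm (f z * cnj (g z)) \<le> norm ((norm (f z))\<^sup>2 + (norm (g z))\<^sup>2)"
    by (intro AE_I2) simp
  show "(\<lambda>z. f z * cnj (g z)) \<in> borel_measurable circle_measure"
    using assms by measurable
qed

lemma inner_add_left: "inner_L2 (x + y) z = inner_L2 x z + inner_L2 y z"
proof -
  obtain f g h where "square_integrable f" "square_integrable g" "square_integrable h"
    and "x = abs_L2 f" "y = abs_L2 g" "z = abs_L2 h"
    using abs_L2_cases by metis
  then show ?thesis
    by (simp add: plus_abs_L2 inner_abs_L2 square_integrable_add distrib_right integrable_mult_cnj)
qed

lemma inner_scale_left: "inner_L2 (c *\<^sub>L x) y = c * inner_L2 x y"
proof -
  obtain f g where "square_integrable f" "square_integrable g" and "x = abs_L2 f" "y = abs_L2 g"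
    using abs_L2_cases by metis
  then show ?thesis
    by (simp add: scale_abs_L2 inner_abs_L2 square_integrable_scale mult.assoc)
qed

lemma inner_commute: "inner_L2 y x = cnj (inner_L2 x y)"
proof -
  obtain f g where "square_integrable f" "square_integrable g" and "x = abs_L2 f" "y = abs_L2 g"
    using abs_L2_cases by metis
  then show ?thesis
    using Bochner_Integration.integral_cnj[of circle_measure "\<lambda>z. f z * cnj (g z)"]
    by (simp add: inner_abs_L2 mult.commute)
qed

lemma inner_add_right: "inner_L2 x (y + z) = inner_L2 x y + inner_L2 x z"
  by (metis inner_commute inner_add_left complex_cnj_add)

lemma inner_scale_right: "inner_L2 x (c *\<^sub>L y) = cnj c * inner_L2 x y"
  by (metis inner_commute inner_scale_left complex_cnj_mult)

lemma inner_zero_left [simp]: "inner_L2 0 y = 0"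
  using inner_scale_left[of 0 0 y] by simp

lemma inner_zero_right [simp]: "inner_L2 x 0 = 0"
  using inner_commute[of x 0] by simp

lemma inner_diff_left: "inner_L2 (x - y) z = inner_L2 x z - inner_L2 y z"
  using inner_add_left[of "x - y" y z] by simp

lemma inner_diff_right: "inner_L2 x (y - z) = inner_L2 x y - inner_L2 x z"
  using inner_add_right[of x "y - z" z] by simp

lemma inner_sum_left: "inner_L2 (\<Sum>i\<in>I. f i) y = (\<Sum>i\<in>I. inner_L2 (f i) y)"
  by (induct I rule: infinite_finite_induct) (auto simp: inner_add_left)

lemma inner_self:
  assumes "square_integrable f"
  shows "inner_L2 (abs_L2 f) (abs_L2 f) = complex_of_real (\<integral>z. (norm (f z))\<^sup>2 \<partial>circle_measure)"
  using assms by (simp add: inner_abs_L2 complex_norm_square del: of_real_power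
      flip: integral_complex_of_real)

lemma inner_self_nonneg: "0 \<le> Re (inner_L2 x x)"
  by (rule abs_L2_cases[of x]) (auto simp: inner_self)

lemma inner_self_eq_0_iff: "inner_L2 x x = 0 \<longleftrightarrow> x = 0"
proof (rule abs_L2_cases[of x])
  fix f assume f: "square_integrable f" and x: "x = abs_L2 f"
  have "inner_L2 x x = 0 \<longleftrightarrow> (\<integral>z. (norm (f z))\<^sup>2 \<partial>circle_measure) = 0"
    using f by (simp only: x inner_self of_real_eq_0_iff)
  also have "\<dots> \<longleftrightarrow> (AE z in circle_measure. (norm (f z))\<^sup>2 = 0)"
    using f by (intro integral_nonneg_eq_0_iff_AE) (auto simp: square_integrable_def)
  also have "\<dots> \<longleftrightarrow> x = 0"
    using abs_L2_eq_iff[OF f square_integrable_zero] by (simp add: x zero_L2_def)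
  finally show ?thesis .
qed

section \<open>Multiplication by continuous functions\<close>

text \<open>
  Multiplication by an element of $L^2$ is well behaved when the factor is bounded. All factors below
  are continuous on the circle. Measurability is required on the whole plane because the values off
  the circle are otherwise arbitrary.
\<close>

definition multiplier :: "(complex \<Rightarrow> complex) \<Rightarrow> bool" where
  "multiplier u \<longleftrightarrow> u \<in> borel_measurable borel \<and> continuous_on (sphere 0 1) u"

named_theorems multiplier_intros

lemma multiplier_measurable [measurable_dest]: "multiplier u \<Longrightarrow> u \<in> borel_measurable borel"
  by (simp add: multiplier_def)

lemma multiplier_const [multiplier_intros]: "multiplier (\<lambda>z. c)"
  and multiplier_ident [multiplier_intros]: "multiplier (\<lambda>z. z)"
  by (auto simp: multiplier_def)

lemma multiplier_add [multiplier_intros]: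
    "multiplier u \<Longrightarrow> multiplier v \<Longrightarrow> multiplier (\<lambda>z. u z + v z)"
  and multiplier_diff [multiplier_intros]:
    "multiplier u \<Longrightarrow> multiplier v \<Longrightarrow> multiplier (\<lambda>z. u z - v z)"
  and multiplier_mult [multiplier_intros]:
    "multiplier u \<Longrightarrow> multiplier v \<Longrightarrow> multiplier (\<lambda>z. u z * v z)"
  and multiplier_cnj [multiplier_intros]:
    "multiplier u \<Longrightarrow> multiplier (\<lambda>z. cnj (u z))"
  unfolding multiplier_def by (auto intro!: continuous_intros)

lemma multiplier_divide [multiplier_intros]:
  "multiplier u \<Longrightarrow> multiplier v \<Longrightarrow> (\<And>z. norm z = 1 \<Longrightarrow> v z \<noteq> 0) \<Longrightarrow>
    multiplier (\<lambda>z. u z / v z)"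
  unfolding multiplier_def by (auto intro!: continuous_intros)

lemma multiplier_sum [multiplier_intros]:
  "(\<And>i. i \<in> I \<Longrightarrow> multiplier (u i)) \<Longrightarrow> multiplier (\<lambda>z. \<Sum>i\<in>I. u i z)"
  by (induct I rule: infinite_finite_induct) (auto intro: multiplier_intros)

lemma multiplier_prod [multiplier_intros]:
  "(\<And>i. i \<in> I \<Longrightarrow> multiplier (u i)) \<Longrightarrow> multiplier (\<lambda>z. \<Prod>i\<in>I. u i z)"
  by (induct I rule: infinite_finite_induct) (auto intro: multiplier_intros)

lemma multiplier_power_int [multiplier_intros]: "multiplier (\<lambda>z. z powi k)"
  unfolding multiplier_def by (auto intro!: continuous_intros simp: power_int_measurable)

lemma multiplier_poly [multiplier_intros]: "multiplier (poly p)"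
  unfolding multiplier_def
  by (auto intro!: continuous_intros borel_measurable_continuous_onI)

text \<open>
  The unit circle is compact.
\<close>

lemma multiplier_bounded:
  assumes "multiplier u"
  obtains M where "\<And>z. norm z = 1 \<Longrightarrow> norm (u z) \<le> M"
proof -
  have "compact (u ` sphere 0 1)"
    using assms by (intro compact_continuous_image) (auto simp: multiplier_def)
  then obtain M where "\<forall>y \<in> u ` sphere 0 1. norm y \<le> M"
    using compact_imp_bounded bounded_iff by metis
  then show ?thesis
    by (intro that[of M]) auto
qed

lemma square_integrable_mult_bound:
  assumes u: "multiplier u" and f: "square_integrable f"
    and M: "\<And>z. norm z = 1 \<Longrightarrow> norm (u z) \<le> M"
  shows "square_integrable (\<lambda>z. u z * f z)"
    and "(\<integral>z. (norm (u z * f z))\<^sup>2 \<partial>circle_measure) \<le> M\<^sup>2 * (\<integral>z. (norm (f z))\<^sup>2 \<partial>circle_measure)"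
proof -
  have [measurable]: "u \<in> borel_measurable borel" "f \<in> borel_measurable borel"
    using u f by measurable
  have int: "integrable circle_measure (\<lambda>z. M\<^sup>2 * (norm (f z))\<^sup>2)"
    using f by (simp add: square_integrable_def)
  have le: "AE z in circle_measure. (norm (u z * f z))\<^sup>2 \<le> M\<^sup>2 * (norm (f z))\<^sup>2"
    using AE_norm_eq_1
  proof eventually_elim
    case (elim z)
    show ?case
      unfolding norm_mult power_mult_distrib
      using M[OF elim] by (intro mult_right_mono power_mono) auto
  qed
  have int': "integrable circle_measure (\<lambda>z. (norm (u z * f z))\<^sup>2)"
    by (rule Bochner_Integration.integrable_bound[OF int]) (use le in auto)
  then show "square_integrable (\<lambda>z. u z * f z)"
    by (simp add: square_integrable_def)
  show "(\<integral>z. (norm (u z * f z))\<^sup>2 \<partial>circle_measure) \<le> M\<^sup>2 * (\<integral>z. (norm (f z))\<^sup>2 \<partial>circle_measure)"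
    using integral_mono_AE[OF int' int le] by simp
qed

lemma square_integrable_mult:
  "multiplier u \<Longrightarrow> square_integrable f \<Longrightarrow> square_integrable (\<lambda>z. u z * f z)"
  by (metis multiplier_bounded square_integrable_mult_bound(1))

lemma square_integrable_multiplier: "multiplier u \<Longrightarrow> square_integrable u"
  using square_integrable_mult[of u "\<lambda>z. 1"] by (simp add: square_integrable_def)

abbreviation mul :: "(complex \<Rightarrow> complex) \<Rightarrow> L2 \<Rightarrow> L2" (infixr \<open>\<odot>\<close> 75) where
  "u \<odot> x \<equiv> mult_L2 (abs_L2 u) x"

lemma mul_abs_L2:
  "multiplier u \<Longrightarrow> square_integrable f \<Longrightarrow> u \<odot> abs_L2 f = abs_L2 (\<lambda>z. u z * f z)"
  by (simp add: mult_L2.abs_eq L2_rel_refl square_integrable_mult square_integrable_multiplier)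

lemma mult_L2_commute: "mult_L2 x y = mult_L2 y x"
proof -
  obtain f g where "square_integrable f" "square_integrable g" and "x = abs_L2 f" "y = abs_L2 g"
    using abs_L2_cases by metis
  then show ?thesis
    by (simp add: mult_L2.abs_eq L2_rel_refl mult.commute)
qed

lemma abs_L2_cong:
  assumes "multiplier u" "multiplier v" "\<And>z. norm z = 1 \<Longrightarrow> u z = v z"
  shows "abs_L2 u = abs_L2 v"
proof (rule abs_L2_cong_AE(2))
  show "AE z in circle_measure. u z = v z"
    using AE_norm_eq_1 by eventually_elim (rule assms)
qed (use assms in \<open>auto simp: square_integrable_multiplier multiplier_def\<close>)

lemma mul_one [simp]: "(\<lambda>z. 1) \<odot> x = x"
  by (rule abs_L2_cases[of x]) (simp add: mul_abs_L2 multiplier_const)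

lemma mul_add: "multiplier u \<Longrightarrow> u \<odot> (x + y) = u \<odot> x + u \<odot> y"
proof -
  assume u: "multiplier u"
  obtain f g where "square_integrable f" "square_integrable g" and "x = abs_L2 f" "y = abs_L2 g"
    using abs_L2_cases by metis
  with u show ?thesis
    by (simp add: plus_abs_L2 mul_abs_L2 square_integrable_mult square_integrable_add distrib_left)
qed

lemma mul_scale: "multiplier u \<Longrightarrow> u \<odot> (c *\<^sub>L x) = c *\<^sub>L (u \<odot> x)"
  by (rule abs_L2_cases[of x])
    (simp add: scale_abs_L2 mul_abs_L2 square_integrable_mult square_integrable_scale mult.left_commute)

lemma mul_zero [simp]: "multiplier u \<Longrightarrow> u \<odot> 0 = 0"
  using mul_scale[of u 0 0] by simp

lemma mul_diff: "multiplier u \<Longrightarrow> u \<odot> (x - y) = u \<odot> x - u \<odot> y"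
  using mul_add[of u "x - y" y] by simp

lemma mul_sum: "multiplier u \<Longrightarrow> u \<odot> (\<Sum>i\<in>I. f i) = (\<Sum>i\<in>I. u \<odot> f i)"
  by (induct I rule: infinite_finite_induct) (auto simp: mul_add)

lemma mul_mul:
  "multiplier u \<Longrightarrow> multiplier v \<Longrightarrow> u \<odot> v \<odot> x = (\<lambda>z. u z * v z) \<odot> x"
  by (rule abs_L2_cases[of x])
    (simp add: mul_abs_L2 square_integrable_mult multiplier_mult mult.assoc)

lemma add_mul:
  "multiplier u \<Longrightarrow> multiplier v \<Longrightarrow> (\<lambda>z. u z + v z) \<odot> x = u \<odot> x + v \<odot> x"
  by (rule abs_L2_cases[of x])
    (simp add: mul_abs_L2 plus_abs_L2 square_integrable_mult multiplier_add distrib_right)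

lemma scale_mul: "multiplier u \<Longrightarrow> (\<lambda>z. c * u z) \<odot> x = c *\<^sub>L (u \<odot> x)"
  by (rule abs_L2_cases[of x])
    (simp add: mul_abs_L2 scale_abs_L2 square_integrable_mult multiplier_intros mult.assoc)

lemma inner_mul_left:
  assumes u: "multiplier u"
  shows "inner_L2 (u \<odot> x) y = inner_L2 x ((\<lambda>z. cnj (u z)) \<odot> y)"
proof -
  obtain f g where "square_integrable f" "square_integrable g" and "x = abs_L2 f" "y = abs_L2 g"
    using abs_L2_cases by metis
  with u show ?thesis
    by (simp add: mul_abs_L2 inner_abs_L2 square_integrable_mult multiplier_cnj mult.assoc
        mult.left_commute)
qed

text \<open>
  A unimodular factor is inverted by its conjugate, which is also the adjoint multiplication.
\<close>

lemma mul_isometry: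
  assumes u: "multiplier u" "\<And>z. norm z = 1 \<Longrightarrow> norm (u z) = 1"
  shows "inner_L2 (u \<odot> x) (u \<odot> y) = inner_L2 x y"
proof -
  have "cnj (u z) * u z = 1" if "norm z = 1" for z
    using u(2)[OF that] complex_norm_square[of "u z"] by (simp add: mult.commute)
  then have "abs_L2 (\<lambda>z. cnj (u z) * u z) = abs_L2 (\<lambda>z. 1)"
    using u by (intro abs_L2_cong multiplier_intros)
  then show ?thesis
    using u(1) by (simp add: inner_mul_left mul_mul multiplier_cnj)
qed

lemma norm_mul_bound:
  assumes u: "multiplier u"
  obtains M where "\<And>x. norm_L2 (u \<odot> x) \<le> M * norm_L2 x"
proof -
  obtain M where M: "\<And>z. norm z = 1 \<Longrightarrow> norm (u z) \<le> M"
    using multiplier_bounded[OF u] by blast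
  have "norm_L2 (u \<odot> x) \<le> \<bar>M\<bar> * norm_L2 x" for x
  proof (rule abs_L2_cases[of x])
    fix f assume f: "square_integrable f" and x: "x = abs_L2 f"
    have "norm_L2 (u \<odot> x) \<le> sqrt (M\<^sup>2 * (\<integral>z. (norm (f z))\<^sup>2 \<partial>circle_measure))"
      unfolding norm_L2_def x mul_abs_L2[OF u f]
      using square_integrable_mult_bound[OF u f M] by (simp add: inner_self)
    also have "\<dots> = \<bar>M\<bar> * norm_L2 x"
      using f by (simp add: norm_L2_def x inner_self real_sqrt_mult)
    finally show ?thesis .
  qed
  then show ?thesis
    by (rule that)
qed

section \<open>Fourier coefficients and the Hardy space\<close>

definition character :: "int \<Rightarrow> L2" (\<open>\<zeta>\<close>) where
  "\<zeta> k = abs_L2 (\<lambda>z. z powi k)"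

lemma cnj_eq_inverse: "norm z = 1 \<Longrightarrow> cnj z = inverse z"
  using complex_norm_square[of z] by (auto simp: divide_simps mult.commute)

lemma nonzero_on_circle: "norm (z::complex) = 1 \<Longrightarrow> z \<noteq> 0"
  by auto

lemma mul_character: "(\<lambda>z. z powi j) \<odot> \<zeta> k = \<zeta> (j + k)"
  unfolding character_def
  by (subst mul_abs_L2)
    (auto intro!: abs_L2_cong multiplier_intros square_integrable_multiplier
      simp: power_int_add nonzero_on_circle)

lemma inner_character: "inner_L2 (\<zeta> j) (\<zeta> k) = (if j = k then 1 else 0)"
proof -
  have "inner_L2 (\<zeta> j) (\<zeta> k) = (\<integral>z. z powi j * cnj (z powi k) \<partial>circle_measure)"
    unfolding character_def
    by (intro inner_abs_L2 square_integrable_multiplier multiplier_intros)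
  also have "\<dots> = (\<integral>z. z powi (j - k) \<partial>circle_measure)"
  proof (rule integral_cong_AE)
    show "AE z in circle_measure. z powi j * cnj (z powi k) = z powi (j - k)"
      using AE_norm_eq_1
      by eventually_elim (simp add: cnj_eq_inverse power_int_diff nonzero_on_circle divide_inverse
          power_int_inverse)
  qed measurable
  finally show ?thesis
    by (simp add: integral_power_int)
qed

lemma mul_cnj_ident_character: "(\<lambda>z. cnj z) \<odot> \<zeta> k = \<zeta> (k - 1)"
  unfolding character_def
  by (subst mul_abs_L2)
    (auto intro!: abs_L2_cong multiplier_intros square_integrable_multiplier
      simp: power_int_diff nonzero_on_circle cnj_eq_inverse divide_inverse mult.commute)

lemma inner_mul_ident_character: "inner_L2 ((\<lambda>z. z) \<odot> x) (\<zeta> k) = inner_L2 x (\<zeta> (k - 1))"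
  by (simp add: inner_mul_left multiplier_ident mul_cnj_ident_character)

lemma linear_mul: "(\<lambda>z. s * z + t) \<odot> x = s *\<^sub>L ((\<lambda>z. z) \<odot> x) + t *\<^sub>L x"
proof -
  have "(\<lambda>z. s * z + t) \<odot> x = (\<lambda>z. s * z) \<odot> x + (\<lambda>z. t) \<odot> x"
    by (rule add_mul[OF multiplier_mult[OF multiplier_const multiplier_ident] multiplier_const])
  moreover have "(\<lambda>z. s * z) \<odot> x = s *\<^sub>L ((\<lambda>z. z) \<odot> x)"
    by (rule scale_mul) (rule multiplier_ident)
  moreover have "(\<lambda>z. t) \<odot> x = t *\<^sub>L x"
    using scale_mul[of "\<lambda>z. 1" t x, OF multiplier_const] unfolding mul_one mult_1_right .
  ultimately show ?thesis
    by metis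
qed

lemma inner_linear_mul_character:
  "inner_L2 ((\<lambda>z. s * z + t) \<odot> x) (\<zeta> k) = s * inner_L2 x (\<zeta> (k - 1)) + t * inner_L2 x (\<zeta> k)"
  by (subst linear_mul) (simp only: inner_add_left inner_scale_left inner_mul_ident_character)

lemma inner_character_bounded:
  obtains B where "\<And>k. norm (inner_L2 x (\<zeta> k)) \<le> B"
proof (rule abs_L2_cases[of x])
  fix f assume f: "square_integrable f" and x: "x = abs_L2 f"
  have [measurable]: "f \<in> borel_measurable borel"
    using f by measurable
  have "norm (inner_L2 x (\<zeta> k)) \<le> (\<integral>z. norm (f z) \<partial>circle_measure)" for k
  proof -
    have "norm (inner_L2 x (\<zeta> k)) \<le> (\<integral>z. norm (f z * cnj (z powi k)) \<partial>circle_measure)"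
      unfolding x character_def inner_abs_L2[OF f square_integrable_multiplier[OF multiplier_power_int]]
      by (rule integral_norm_bound)
    also have "\<dots> = (\<integral>z. norm (f z) \<partial>circle_measure)"
    proof (rule integral_cong_AE)
      show "AE z in circle_measure. norm (f z * cnj (z powi k)) = norm (f z)"
        using AE_norm_eq_1 by eventually_elim (simp add: norm_mult norm_power_int)
    qed measurable
    finally show ?thesis .
  qed
  then show ?thesis
    by (rule that)
qed

text \<open>
  Going back from index $n$ to index $0$ contracts by the factor $a^n$. This elementary fact replaces
  power series expansions of $1 / (1 - \overline{a} z)$ and $1 / (z - a)$ on the circle.
\<close>

lemma bounded_backward_geometric_eq_0:
  fixes d :: "nat \<Rightarrow> complex"
  assumes bound: "\<And>n. norm (d n) \<le> B" and step: "\<And>n. d n = a * d (Suc n)" and a: "norm a < 1"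
  shows "d 0 = 0"
proof -
  have eq: "a ^ n * d n = d 0" for n
  proof (induct n)
    case (Suc n)
    have "a ^ Suc n * d (Suc n) = a ^ n * (a * d (Suc n))"
      by (simp add: mult_ac)
    also have "\<dots> = a ^ n * d n"
      by (simp only: step[of n])
    finally show ?case
      by (simp only: Suc)
  qed simp
  have lim: "(\<lambda>n. norm a ^ n * B) \<longlonglongrightarrow> 0"
    using tendsto_mult_right[OF LIMSEQ_power_zero[of "norm a"], of B] a by simp
  have "norm (d 0) \<le> norm a ^ n * B" for n
    unfolding eq[of n, symmetric] norm_mult norm_power by (intro mult_left_mono bound) simp
  then have "norm (d 0) \<le> 0"
    using LIMSEQ_le_const[OF lim] by blast
  then show ?thesis
    by simp
qed

lemma H2_iff: "x \<in> H2 \<longleftrightarrow> (\<forall>k<0. inner_L2 x (\<zeta> k) = 0)"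
  by (simp add: H2_def character_def)

text \<open>
  Division by $1 - \overline{a} z$ preserves $H^2$. If $g$ is the quotient, the vanishing of the
  coefficients of negative index of $(1 - \overline{a} z) g$ says that those of $g$ satisfy
  $g_k = \overline{a} g_{k-1}$, and bounded coefficients with this property vanish.
\<close>

lemma mul_factor_in_H2_iff:
  assumes a: "norm a < 1"
  shows "(\<lambda>z. 1 - cnj a * z) \<odot> x \<in> H2 \<longleftrightarrow> x \<in> H2"
proof -
  have coeff: "inner_L2 ((\<lambda>z. 1 - cnj a * z) \<odot> x) (\<zeta> k) =
      inner_L2 x (\<zeta> k) - cnj a * inner_L2 x (\<zeta> (k - 1))" for k
    using inner_linear_mul_character[of "- cnj a" 1 x k] by (simp add: algebra_simps)
  obtain B where B: "\<And>k. norm (inner_L2 x (\<zeta> k)) \<le> B"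
    using inner_character_bounded by blast
  show ?thesis
  proof
    assume L: "(\<lambda>z. 1 - cnj a * z) \<odot> x \<in> H2"
    have "inner_L2 x (\<zeta> k) = 0" if "k < 0" for k
    proof -
      have step: "inner_L2 x (\<zeta> (k - int n)) = cnj a * inner_L2 x (\<zeta> (k - int (Suc n)))" for n
        using L coeff[of "k - int n"] that by (simp add: H2_iff algebra_simps)
      have "inner_L2 x (\<zeta> (k - int 0)) = 0"
        by (rule bounded_backward_geometric_eq_0[where a = "cnj a"], rule B, rule step) (simp add: a)
      then show ?thesis
        by simp
    qed
    then show "x \<in> H2"
      by (simp add: H2_iff)
  next
    assume "x \<in> H2"
    then show "(\<lambda>z. 1 - cnj a * z) \<odot> x \<in> H2"
      unfolding H2_iff coeff by simp
  qed
qed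

lemma inner_mul_factor_constant:
  assumes "x \<in> H2"
  shows "inner_L2 ((\<lambda>z. 1 - cnj a * z) \<odot> x) (\<zeta> 0) = inner_L2 x (\<zeta> 0)"
  using inner_linear_mul_character[of "- cnj a" 1 x 0] assms by (simp add: H2_iff)

text \<open>
  The mirror image of the argument for \<open>mul_factor_in_H2_iff\<close>: now the coefficients satisfy
  $x_k = a x_{k+1}$ for all $k$.
\<close>

lemma character_orthogonal_cancel_zero:
  assumes a: "norm a < 1" and x: "\<And>k. inner_L2 ((\<lambda>z. z - a) \<odot> x) (\<zeta> k) = 0"
  shows "inner_L2 x (\<zeta> k) = 0"
proof -
  obtain B where B: "\<And>k. norm (inner_L2 x (\<zeta> k)) \<le> B"
    using inner_character_bounded by blast
  have step: "inner_L2 x (\<zeta> (k + int n)) = a * inner_L2 x (\<zeta> (k + int (Suc n)))" for n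
    using x[of "k + int (Suc n)"] inner_linear_mul_character[of 1 "- a" x "k + int (Suc n)"]
    by (simp add: algebra_simps)
  have "inner_L2 x (\<zeta> (k + int 0)) = 0"
    by (rule bounded_backward_geometric_eq_0, rule B, rule step, rule a)
  then show ?thesis
    by simp
qed

lemma mul_denominator_in_H2_iff:
  fixes m :: nat
  assumes "\<And>i. i < m \<Longrightarrow> norm (a i) < 1"
  shows "(\<lambda>z. \<Prod>i<m. (1 - cnj (a i) * z)) \<odot> x \<in> H2 \<longleftrightarrow> x \<in> H2"
  using assms
proof (induct m arbitrary: x)
  case (Suc m)
  have "(\<lambda>z. \<Prod>i<Suc m. (1 - cnj (a i) * z)) \<odot> x =
      (\<lambda>z. \<Prod>i<m. (1 - cnj (a i) * z)) \<odot> (\<lambda>z. 1 - cnj (a m) * z) \<odot> x"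
    unfolding prod.lessThan_Suc by (rule mul_mul[symmetric]) (intro multiplier_intros)+
  moreover have "(\<lambda>z. \<Prod>i<m. (1 - cnj (a i) * z)) \<odot> (\<lambda>z. 1 - cnj (a m) * z) \<odot> x \<in> H2 \<longleftrightarrow>
      (\<lambda>z. 1 - cnj (a m) * z) \<odot> x \<in> H2"
    by (rule Suc.hyps) (simp add: Suc.prems)
  moreover have "(\<lambda>z. 1 - cnj (a m) * z) \<odot> x \<in> H2 \<longleftrightarrow> x \<in> H2"
    by (rule mul_factor_in_H2_iff) (simp add: Suc.prems)
  ultimately show ?case
    by metis
qed simp

lemma inner_mul_denominator_constant:
  fixes m :: nat
  assumes "\<And>i. i < m \<Longrightarrow> norm (a i) < 1" and "x \<in> H2"
  shows "inner_L2 ((\<lambda>z. \<Prod>i<m. (1 - cnj (a i) * z)) \<odot> x) (\<zeta> 0) = inner_L2 x (\<zeta> 0)"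
  using assms
proof (induct m arbitrary: x)
  case (Suc m)
  have "(\<lambda>z. \<Prod>i<Suc m. (1 - cnj (a i) * z)) \<odot> x =
      (\<lambda>z. \<Prod>i<m. (1 - cnj (a i) * z)) \<odot> (\<lambda>z. 1 - cnj (a m) * z) \<odot> x"
    unfolding prod.lessThan_Suc by (rule mul_mul[symmetric]) (intro multiplier_intros)+
  moreover have "(\<lambda>z. 1 - cnj (a m) * z) \<odot> x \<in> H2"
    using Suc.prems mul_factor_in_H2_iff by blast
  then have "inner_L2 ((\<lambda>z. \<Prod>i<m. (1 - cnj (a i) * z)) \<odot> (\<lambda>z. 1 - cnj (a m) * z) \<odot> x) (\<zeta> 0) =
      inner_L2 ((\<lambda>z. 1 - cnj (a m) * z) \<odot> x) (\<zeta> 0)"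
    by (intro Suc.hyps) (simp_all only: Suc.prems less_SucI)
  ultimately show ?case
    using inner_mul_factor_constant[OF Suc.prems(2)] by metis
qed simp

lemma character_orthogonal_cancel_zeros:
  fixes m :: nat
  assumes "\<And>i. i < m \<Longrightarrow> norm (a i) < 1"
    and "\<And>k. inner_L2 ((\<lambda>z. \<Prod>i<m. (z - a i)) \<odot> x) (\<zeta> k) = 0"
  shows "inner_L2 x (\<zeta> k) = 0"
  using assms
proof (induct m arbitrary: x k)
  case (Suc m)
  have eq: "(\<lambda>z. \<Prod>i<Suc m. (z - a i)) \<odot> x = (\<lambda>z. \<Prod>i<m. (z - a i)) \<odot> (\<lambda>z. z - a m) \<odot> x"
    unfolding prod.lessThan_Suc by (rule mul_mul[symmetric]) (intro multiplier_intros)+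
  have "inner_L2 ((\<lambda>z. z - a m) \<odot> x) (\<zeta> k) = 0" for k
    by (rule Suc.hyps) (simp_all only: Suc.prems less_SucI flip: eq)
  then show ?case
    by (rule character_orthogonal_cancel_zero[rotated]) (simp only: Suc.prems lessI)
qed simp

section \<open>The model space of a finite Blaschke product\<close>

lemma multiplier_linear: "multiplier (\<lambda>z. s * z + t)"
  by (intro multiplier_add multiplier_mult multiplier_const multiplier_ident)

lemma subspace_H2: "L2.subspace H2"
  by (rule L2.subspaceI) (auto simp: H2_iff inner_add_left inner_scale_left)

lemma character_in_H2: "0 \<le> k \<Longrightarrow> \<zeta> k \<in> H2"
  by (auto simp: H2_iff inner_character)

lemma subspace_model_space: "L2.subspace (model_space \<alpha>)"
  by (rule L2.subspaceI)
    (auto simp: model_space_def inner_add_left inner_scale_left L2.subspace_0[OF subspace_H2]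
      L2.subspace_add[OF subspace_H2] L2.subspace_scale[OF subspace_H2])

text \<open>
  The data of a finite Blaschke product $c P / q$; the comments write $P$ and $q$ for \<open>num\<close> and
  \<open>den\<close>, and $\alpha$ for the product, which is \<open>B\<close> below. Positivity of the degree
  puts $1 / q$ into the model space, so that $\alpha$ is orthogonal to it.
\<close>

locale blaschke =
  fixes c :: complex and a :: "nat \<Rightarrow> complex" and m :: nat
  assumes norm_c: "norm c = 1"
    and zeros_in_disk: "i < m \<Longrightarrow> norm (a i) < 1"
    and degree_pos: "0 < m"
begin

definition num :: "complex \<Rightarrow> complex" where
  "num z = (\<Prod>i<m. (z - a i))"

definition den :: "complex \<Rightarrow> complex" where
  "den z = (\<Prod>i<m. (1 - cnj (a i) * z))"

definition B :: "complex \<Rightarrow> complex" where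
  "B z = c * (num z / den z)"

lemma den_nonzero:
  assumes "norm z \<le> 1"
  shows "den z \<noteq> 0"
proof -
  have "1 - cnj (a i) * z \<noteq> 0" if "i < m" for i
  proof
    assume "1 - cnj (a i) * z = 0"
    then have "norm (a i) * norm z = 1"
      by (metis complex_mod_cnj eq_iff_diff_eq_0 norm_mult norm_one)
    moreover have "norm (a i) * norm z \<le> norm (a i) * 1"
      using assms by (intro mult_left_mono) auto
    ultimately show False
      using zeros_in_disk[OF that] by simp
  qed
  then show ?thesis
    by (simp add: den_def)
qed

text \<open>
  The zeros and the poles are symmetric with respect to the circle, where $z - a = z \overline{(1 - \overline{a} z)}$.
\<close>

lemma num_reflect:
  assumes "norm z = 1"
  shows "num z = z ^ m * cnj (den z)"
proof -
  have "z - a i = z * cnj (1 - cnj (a i) * z)" for i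
    using assms by (simp add: cnj_eq_inverse right_diff_distrib nonzero_on_circle)
  then show ?thesis
    by (simp add: num_def den_def prod.distrib)
qed

lemma norm_B:
  assumes "norm z = 1"
  shows "norm (B z) = 1"
  using den_nonzero[of z] assms norm_c by (simp add: B_def num_reflect norm_mult norm_divide norm_power)

lemma multiplier_num: "multiplier num"
  and multiplier_den: "multiplier den"
  unfolding num_def den_def by (intro multiplier_intros)+

lemma multiplier_inverse_den: "multiplier (\<lambda>z. 1 / den z)"
  by (intro multiplier_divide multiplier_const multiplier_den den_nonzero) simp

lemma multiplier_B: "multiplier B"
  unfolding B_def
  by (intro multiplier_mult multiplier_divide multiplier_const multiplier_num multiplier_den
      den_nonzero) simp

lemma mul_den_inverse: "den \<odot> (\<lambda>z. 1 / den z) \<odot> x = x"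
proof -
  have "abs_L2 (\<lambda>z. den z * (1 / den z)) = abs_L2 (\<lambda>z. 1)"
    by (intro abs_L2_cong multiplier_mult multiplier_den multiplier_inverse_den multiplier_const)
      (simp add: den_nonzero)
  then show ?thesis
    by (simp add: mul_mul multiplier_den multiplier_inverse_den)
qed

lemma mul_den_in_H2_iff: "den \<odot> x \<in> H2 \<longleftrightarrow> x \<in> H2"
  unfolding den_def by (rule mul_denominator_in_H2_iff) (rule zeros_in_disk)

text \<open>
  The vectors $z^k / q$; those with $0 \le k < m$ form the basis of the model space. The index is an
  integer because differences of indices occur as Fourier frequencies.
\<close>

definition E :: "int \<Rightarrow> L2" where
  "E k = (\<lambda>z. 1 / den z) \<odot> \<zeta> k"

lemma mul_den_E: "den \<odot> E k = \<zeta> k"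
  by (simp add: E_def mul_den_inverse)

lemma E_in_H2: "0 \<le> k \<Longrightarrow> E k \<in> H2"
  using mul_den_in_H2_iff[of "E k"] by (simp add: mul_den_E character_in_H2)

text \<open>
  On the circle $\overline{\alpha} z^k / q = \overline{c} z^{k-m} / \overline{q}$, so the inner product
  with $\alpha h$ is a Fourier coefficient of negative index of $h / q$, which lies in $H^2$.
\<close>

lemma E_orthogonal_B_H2:
  assumes "k < int m" "h \<in> H2"
  shows "inner_L2 (E k) (B \<odot> h) = 0"
proof -
  have "cnj (B z) * (1 / den z) = cnj c * (z powi (- int m) * cnj (1 / den z))" if "norm z = 1" for z
  proof -
    have "cnj (num z) * z ^ m = den z"
      using that arg_cong[OF num_reflect[OF that], of cnj]
      by (simp add: cnj_eq_inverse nonzero_on_circle power_inverse)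
    then show ?thesis
      using that den_nonzero[of z]
      by (simp add: B_def power_int_minus divide_simps nonzero_on_circle mult_ac)
  qed
  then have "abs_L2 (\<lambda>z. cnj (B z) * (1 / den z)) =
      abs_L2 (\<lambda>z. cnj c * (z powi (- int m) * cnj (1 / den z)))"
    by (intro abs_L2_cong multiplier_mult multiplier_cnj multiplier_B multiplier_inverse_den
        multiplier_const multiplier_power_int)
  then have "(\<lambda>z. cnj (B z)) \<odot> E k =
      cnj c *\<^sub>L ((\<lambda>z. cnj (1 / den z)) \<odot> (\<lambda>z. z powi (- int m)) \<odot> \<zeta> k)"
    by (simp only: E_def mul_mul multiplier_cnj multiplier_B multiplier_inverse_den
        multiplier_mult multiplier_power_int scale_mul mult.commute)
  then have "inner_L2 (E k) (B \<odot> h) =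
      cnj c * inner_L2 (\<zeta> (k - int m)) ((\<lambda>z. 1 / den z) \<odot> h)"
    using inner_mul_left[OF multiplier_cnj[OF multiplier_B], of "E k" h]
      inner_mul_left[OF multiplier_cnj[OF multiplier_inverse_den], of "\<zeta> (k - int m)" h]
    by (simp only: complex_cnj_cnj inner_scale_left mul_character) (simp add: algebra_simps)
  also have "(\<lambda>z. 1 / den z) \<odot> h \<in> H2"
    using assms(2) mul_den_in_H2_iff[of "(\<lambda>z. 1 / den z) \<odot> h"] by (simp add: mul_den_inverse)
  then have "inner_L2 (\<zeta> (k - int m)) ((\<lambda>z. 1 / den z) \<odot> h) = 0"
    using assms(1) inner_commute[of "(\<lambda>z. 1 / den z) \<odot> h" "\<zeta> (k - int m)"] by (simp add: H2_iff)
  finally show ?thesis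
    by simp
qed

lemma E_in_model_space: "0 \<le> k \<Longrightarrow> k < int m \<Longrightarrow> E k \<in> model_space B"
  unfolding model_space_def by (simp add: E_in_H2 E_orthogonal_B_H2)

lemma inner_E_constant: "0 \<le> k \<Longrightarrow> inner_L2 (E k) (\<zeta> 0) = (if k = 0 then 1 else 0)"
  using inner_mul_denominator_constant[of m a "E k"] zeros_in_disk
  by (simp add: mul_den_E inner_character E_in_H2 flip: den_def)

text \<open>
  For $k \ge m$ one has $\overline{q} z^k = P z^{k-m}$ on the circle, and $P z^{k-m}$ is a multiple of
  $\alpha q z^{k-m}$, which lies in $\alpha H^2$.
\<close>

lemma inner_mul_den_character:
  assumes x: "x \<in> model_space B" and k: "int m \<le> k"
  shows "inner_L2 (den \<odot> x) (\<zeta> k) = 0"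
proof -
  have "cnj (den z) * z powi k = B z * (1 / c * (den z * z powi (k - int m)))" if "norm z = 1" for z
    using that den_nonzero[of z] norm_c
    by (auto simp: B_def num_reflect power_int_diff nonzero_on_circle)
  then have "abs_L2 (\<lambda>z. cnj (den z) * z powi k) =
      abs_L2 (\<lambda>z. B z * (1 / c * (den z * z powi (k - int m))))"
    by (intro abs_L2_cong multiplier_mult multiplier_cnj multiplier_B multiplier_den
        multiplier_const multiplier_power_int)
  moreover have "(\<lambda>z. cnj (den z)) \<odot> \<zeta> k = (\<lambda>z. cnj (den z) * z powi k) \<odot> \<zeta> 0"
    using mul_mul[OF multiplier_cnj[OF multiplier_den] multiplier_power_int, of k "\<zeta> 0"]
    by (simp only: mul_character add_0_right)
  moreover have "B \<odot> (1 / c) *\<^sub>L (den \<odot> \<zeta> (k - int m)) =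
      (\<lambda>z. B z * (1 / c * (den z * z powi (k - int m)))) \<odot> \<zeta> 0"
  proof -
    have "den \<odot> \<zeta> (k - int m) = (\<lambda>z. den z * z powi (k - int m)) \<odot> \<zeta> 0"
      using mul_mul[OF multiplier_den multiplier_power_int, of "k - int m" "\<zeta> 0"]
      by (simp only: mul_character add_0_right)
    then have "(1 / c) *\<^sub>L (den \<odot> \<zeta> (k - int m)) =
        (\<lambda>z. 1 / c * (den z * z powi (k - int m))) \<odot> \<zeta> 0"
      by (simp only: scale_mul multiplier_mult multiplier_den multiplier_power_int)
    then show ?thesis
      by (simp only: mul_mul multiplier_B multiplier_mult multiplier_const multiplier_den
          multiplier_power_int)
  qed
  ultimately have "(\<lambda>z. cnj (den z)) \<odot> \<zeta> k = B \<odot> (1 / c) *\<^sub>L (den \<odot> \<zeta> (k - int m))"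
    by (simp only:)
  moreover have "(1 / c) *\<^sub>L (den \<odot> \<zeta> (k - int m)) \<in> H2"
    using k by (intro L2.subspace_scale[OF subspace_H2]) (simp add: mul_den_in_H2_iff character_in_H2)
  ultimately show ?thesis
    using x by (simp add: inner_mul_left multiplier_den model_space_def)
qed

text \<open>
  This is where completeness of the trigonometric system would be expected. It can be avoided:
  $h = \overline{\alpha} x$ satisfies $P h = \overline{c} q x$, so all its Fourier coefficients vanish
  too. In particular $h$ is in $H^2$, hence $x$ is orthogonal to $\alpha h = |\alpha|^2 x = x$.
\<close>

lemma model_space_eq_0:
  assumes x: "x \<in> model_space B" and coeff: "\<And>k. inner_L2 (den \<odot> x) (\<zeta> k) = 0"
  shows "x = 0"
proof -
  define h where "h = (\<lambda>z. cnj (B z)) \<odot> x"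
  have "num z * cnj (B z) = cnj c * den z" if "norm z = 1" for z
  proof -
    have "cnj (num z) * z ^ m = den z"
      using that arg_cong[OF num_reflect[OF that], of cnj]
      by (simp add: cnj_eq_inverse nonzero_on_circle power_inverse)
    moreover have "num z = z ^ m * cnj (den z)"
      by (rule num_reflect) (rule that)
    ultimately show ?thesis
      using that den_nonzero[of z] by (simp add: B_def mult_ac)
  qed
  then have "abs_L2 (\<lambda>z. num z * cnj (B z)) = abs_L2 (\<lambda>z. cnj c * den z)"
    by (intro abs_L2_cong multiplier_mult multiplier_cnj multiplier_B multiplier_den
        multiplier_const multiplier_num)
  then have "num \<odot> h = cnj c *\<^sub>L (den \<odot> x)"
    by (simp only: h_def mul_mul multiplier_num multiplier_cnj multiplier_B scale_mul multiplier_den)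
  then have "inner_L2 (num \<odot> h) (\<zeta> k) = 0" for k
    by (simp add: inner_scale_left coeff)
  then have "inner_L2 h (\<zeta> k) = 0" for k
    unfolding num_def by (rule character_orthogonal_cancel_zeros[rotated]) (rule zeros_in_disk)
  then have "h \<in> H2"
    by (simp add: H2_iff)
  then have "inner_L2 x (B \<odot> h) = 0"
    using x by (simp add: model_space_def)
  then have "inner_L2 h h = 0"
    using inner_mul_left[OF multiplier_cnj[OF multiplier_B], of x h] by (simp flip: h_def)
  moreover have "inner_L2 h h = inner_L2 x x"
    unfolding h_def by (intro mul_isometry multiplier_cnj multiplier_B) (simp add: norm_B)
  ultimately show ?thesis
    by (simp add: inner_self_eq_0_iff)
qed

text \<open>
  For $x$ in the model space, $q x$ has Fourier coefficients only at frequencies $0, \dots, m - 1$.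
  Subtracting the combination of the basis vectors with these coefficients leaves an element to which
  the preceding lemma applies.
\<close>

lemma model_space_eq_span: "model_space B = L2.span (E ` {0..<int m})"
proof
  show "L2.span (E ` {0..<int m}) \<subseteq> model_space B"
    by (rule L2.span_minimal[OF _ subspace_model_space]) (auto simp: E_in_model_space)
  show "model_space B \<subseteq> L2.span (E ` {0..<int m})"
  proof
    fix x assume x: "x \<in> model_space B"
    define p where "p = (\<Sum>k\<in>{0..<int m}. inner_L2 (den \<odot> x) (\<zeta> k) *\<^sub>L E k)"
    have p_span: "p \<in> L2.span (E ` {0..<int m})"
      unfolding p_def by (intro L2.span_sum L2.span_scale L2.span_base) auto
    have "p \<in> model_space B"
      unfolding p_def
      by (intro L2.subspace_sum[OF subspace_model_space] L2.subspace_scale[OF subspace_model_space]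
          E_in_model_space) auto
    then have xp: "x - p \<in> model_space B"
      by (intro L2.subspace_diff[OF subspace_model_space] x)
    have "inner_L2 (den \<odot> (x - p)) (\<zeta> k) = 0" for k
    proof -
      have p: "den \<odot> p = (\<Sum>k\<in>{0..<int m}. inner_L2 (den \<odot> x) (\<zeta> k) *\<^sub>L \<zeta> k)"
        by (simp add: p_def mul_sum mul_scale multiplier_den mul_den_E)
      have "inner_L2 (den \<odot> p) (\<zeta> k) =
          (\<Sum>j\<in>{0..<int m}. if j = k then inner_L2 (den \<odot> x) (\<zeta> k) else 0)"
        unfolding p inner_sum_left by (intro sum.cong) (auto simp: inner_scale_left inner_character)
      moreover have "inner_L2 (den \<odot> x) (\<zeta> k) = 0" if "k \<notin> {0..<int m}"
      proof (cases "k < 0")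
        case True
        have "den \<odot> x \<in> H2"
          using x by (simp add: mul_den_in_H2_iff model_space_def)
        then show ?thesis
          using True by (simp add: H2_iff)
      next
        case False
        then show ?thesis
          using that x by (intro inner_mul_den_character) auto
      qed
      ultimately show ?thesis
        by (auto simp: mul_diff multiplier_den inner_diff_left)
    qed
    then have "x - p = 0"
      by (rule model_space_eq_0[OF xp])
    then show "x \<in> L2.span (E ` {0..<int m})"
      using p_span by simp
  qed
qed

lemma model_space_orthogonal_eq_0:
  assumes x: "x \<in> model_space B" and orth: "\<And>k. 0 \<le> k \<Longrightarrow> k < int m \<Longrightarrow> inner_L2 x (E k) = 0"
  shows "x = 0"
proof -
  have "L2.span (E ` {0..<int m}) \<subseteq> {y. inner_L2 x y = 0}"
    by (rule L2.span_minimal)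
      (auto intro!: L2.subspaceI simp: orth inner_add_right inner_scale_right)
  then have "inner_L2 x x = 0"
    using x by (auto simp: model_space_eq_span)
  then show ?thesis
    by (simp add: inner_self_eq_0_iff)
qed

text \<open>
  Multiplication by $z$ shifts the basis, and both $\alpha$ and $1$ are orthogonal to $z^k / q$ for
  $0 < k < m$: the first because $z^k / q$ belongs to the model space, the second because
  $z^k / q$ vanishes at the origin.
\<close>

lemma inner_E_recurrence:
  assumes eq: "(\<lambda>z. s * z + t) \<odot> x = u *\<^sub>L (B \<odot> \<zeta> 0) + v *\<^sub>L \<zeta> 0"
    and k: "0 < k" "k < int m"
  shows "s * inner_L2 x (E (k - 1)) + t * inner_L2 x (E k) = 0"
proof -
  have "(\<lambda>z. cnj z) \<odot> E k = E (k - 1)"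
    unfolding E_def mul_cnj_ident_character[symmetric]
    by (simp only: mul_mul multiplier_inverse_den multiplier_cnj multiplier_ident mult.commute)
  then have "inner_L2 ((\<lambda>z. z) \<odot> x) (E k) = inner_L2 x (E (k - 1))"
    by (simp add: inner_mul_left multiplier_ident)
  moreover have "inner_L2 (B \<odot> \<zeta> 0) (E k) = 0"
    using k E_orthogonal_B_H2[of k "\<zeta> 0"] character_in_H2[of 0] inner_commute[of "B \<odot> \<zeta> 0" "E k"]
    by simp
  moreover have "inner_L2 (\<zeta> 0) (E k) = 0"
    using k inner_E_constant[of k] inner_commute[of "\<zeta> 0" "E k"] by simp
  ultimately show ?thesis
    using arg_cong[OF eq[unfolded linear_mul], of "\<lambda>y. inner_L2 y (E k)"]
    by (simp add: inner_add_left inner_scale_left)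
qed

text \<open>
  If $u \alpha + v = 0$, pairing with $1 / q$ gives $v = 0$, because $\alpha$ is orthogonal to it and
  $\langle 1, 1/q \rangle = 1$; then $u = 0$ because $|\alpha| = 1$.
\<close>

lemma linear_mul_nonzero:
  assumes eq: "(\<lambda>z. s * z + t) \<odot> x = u *\<^sub>L (B \<odot> \<zeta> 0) + v *\<^sub>L \<zeta> 0"
    and uv: "u \<noteq> 0 \<or> v \<noteq> 0"
  shows "x \<noteq> 0"
proof
  assume "x = 0"
  then have 0: "u *\<^sub>L (B \<odot> \<zeta> 0) + v *\<^sub>L \<zeta> 0 = 0"
    using eq mul_zero[OF multiplier_linear, of s t] by simp
  have "inner_L2 (B \<odot> \<zeta> 0) (E 0) = 0"
    using degree_pos E_orthogonal_B_H2[of 0 "\<zeta> 0"] character_in_H2[of 0]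
      inner_commute[of "B \<odot> \<zeta> 0" "E 0"] by simp
  moreover have "inner_L2 (\<zeta> 0) (E 0) = 1"
    using inner_E_constant[of 0] inner_commute[of "\<zeta> 0" "E 0"] by simp
  ultimately have "v = 0"
    using arg_cong[OF 0, of "\<lambda>y. inner_L2 y (E 0)"] by (simp add: inner_add_left inner_scale_left)
  moreover have "inner_L2 (B \<odot> \<zeta> 0) (B \<odot> \<zeta> 0) = 1"
    by (simp add: mul_isometry multiplier_B norm_B inner_character)
  then have "B \<odot> \<zeta> 0 \<noteq> 0"
    by auto
  ultimately show False
    using 0 uv by simp
qed

end

section \<open>Reproducing kernels and conjugate kernels\<close>

text \<open>
  A divided difference of $P$ and $q$. The point is the degree bound on the quotient, which says that
  the quotient divided by $q$ lies in the model space. Telescoping over the factors reduces the claim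
  to a single factor, and it needs no distinction between $w$ inside the disk, at $0$, or on the circle.
\<close>

lemma bezoutian:
  fixes a x y \<kappa> :: "nat \<Rightarrow> complex" and m :: nat
  assumes factor: "\<And>i z. (1 - cnj (a i) * z) * x i - (z - a i) * y i = \<kappa> i * (s * z + t)"
  obtains N where "\<And>i. m \<le> i \<Longrightarrow> coeff N i = 0"
    and "\<And>z. (\<Prod>i<m. (1 - cnj (a i) * z)) * (\<Prod>i<m. x i) - (\<Prod>i<m. (z - a i)) * (\<Prod>i<m. y i)
      = (s * z + t) * poly N z"
proof -
  have "\<exists>N. (\<forall>i\<ge>m. coeff N i = 0) \<and>
    (\<forall>z. (\<Prod>i<m. (1 - cnj (a i) * z)) * (\<Prod>i<m. x i) - (\<Prod>i<m. (z - a i)) * (\<Prod>i<m. y i)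
      = (s * z + t) * poly N z)"
  proof (induct m)
    case 0
    show ?case
      by (rule exI[of _ 0]) simp
  next
    case (Suc m)
    then obtain N where N: "\<And>i. m \<le> i \<Longrightarrow> coeff N i = 0"
      "\<And>z. (\<Prod>i<m. (1 - cnj (a i) * z)) * (\<Prod>i<m. x i) - (\<Prod>i<m. (z - a i)) * (\<Prod>i<m. y i)
        = (s * z + t) * poly N z"
      by blast
    define P where "P = (\<Prod>i<m. [:- a i, 1:])"
    define Y where "Y = (\<Prod>i<m. y i)"
    \<comment> \<open>Splitting the new numerator as $f x (q X - P Y) + P Y (f x - g y)$, with $f$ and $g$ the new factors of
    $q$ and $P$, lets the induction hypothesis and \<open>factor\<close> apply to one summand each.\<close>
    define N' where "N' = smult (x m) ([:1, - cnj (a m):] * N) + smult (\<kappa> m * Y) P"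
    have poly_P: "poly P z = (\<Prod>i<m. (z - a i))" for z
      by (simp add: P_def poly_prod)
    have "degree P \<le> (\<Sum>i<m. degree [:- a i, 1:])"
      unfolding P_def using degree_prod_sum_le[of "{..<m}" "\<lambda>i. [:- a i, 1:]"] by (simp add: o_def)
    then have "degree P \<le> m"
      by simp
    then have "coeff N' i = 0" if "Suc m \<le> i" for i
      using that N(1)[of i] N(1)[of "i - 1"]
      by (auto simp: N'_def coeff_pCons coeff_eq_0 split: nat.split)
    moreover have "(\<Prod>i<Suc m. (1 - cnj (a i) * z)) * (\<Prod>i<Suc m. x i)
        - (\<Prod>i<Suc m. (z - a i)) * (\<Prod>i<Suc m. y i) = (s * z + t) * poly N' z" for z
    proof -
      let ?q = "\<Prod>i<m. (1 - cnj (a i) * z)" and ?X = "\<Prod>i<m. x i"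
      have "(\<Prod>i<Suc m. (1 - cnj (a i) * z)) * (\<Prod>i<Suc m. x i)
          - (\<Prod>i<Suc m. (z - a i)) * (\<Prod>i<Suc m. y i) =
        (1 - cnj (a m) * z) * x m * (?q * ?X - poly P z * Y) +
        poly P z * Y * ((1 - cnj (a m) * z) * x m - (z - a m) * y m)"
        unfolding prod.lessThan_Suc poly_P Y_def by (simp add: algebra_simps)
      also have "\<dots> = (s * z + t) * poly N' z"
        unfolding factor unfolding poly_P Y_def N(2) unfolding N'_def by (simp add: poly_P Y_def algebra_simps)
      finally show ?thesis .
    qed
    ultimately show ?case
      by blast
  qed
  then show ?thesis
    using that by blast
qed

lemma abs_L2_sum_characters:
  fixes e :: "'i \<Rightarrow> int"
  shows "finite I \<Longrightarrow> abs_L2 (\<lambda>z. \<Sum>k\<in>I. f k * z powi e k) = (\<Sum>k\<in>I. f k *\<^sub>L \<zeta> (e k))"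
proof (induct I rule: finite_induct)
  case empty
  show ?case
    by (simp add: zero_L2_def)
next
  case (insert j I)
  have "square_integrable (\<lambda>z. f j * z powi e j)" "square_integrable (\<lambda>z. \<Sum>k\<in>I. f k * z powi e k)"
    by (intro square_integrable_multiplier multiplier_intros)+
  then have "abs_L2 (\<lambda>z. f j * z powi e j + (\<Sum>k\<in>I. f k * z powi e k)) =
      abs_L2 (\<lambda>z. f j * z powi e j) + abs_L2 (\<lambda>z. \<Sum>k\<in>I. f k * z powi e k)"
    by (simp only: plus_abs_L2)
  also have "abs_L2 (\<lambda>z. f j * z powi e j) = f j *\<^sub>L \<zeta> (e j)"
    unfolding character_def
    by (intro scale_abs_L2[symmetric] square_integrable_multiplier multiplier_power_int)
  finally show ?case
    using insert by simp
qed

context blaschke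
begin

lemma polynomial_over_den_in_model_space:
  assumes "\<And>i. m \<le> i \<Longrightarrow> coeff N i = 0"
  shows "abs_L2 (\<lambda>z. C * (1 / den z * poly N z)) \<in> model_space B"
proof -
  have "poly N z = (\<Sum>k<m. coeff N k * z powi int k)" for z
    unfolding poly_altdef power_int_of_nat
    using assms by (intro sum.mono_neutral_cong) (auto simp: coeff_eq_0)
  then have expand: "poly N = (\<lambda>z. \<Sum>k<m. coeff N k * z powi int k)"
    by (rule ext)
  have "abs_L2 (poly N) = (\<Sum>k<m. coeff N k *\<^sub>L \<zeta> (int k))"
    unfolding expand by (rule abs_L2_sum_characters) simp
  then have "(\<lambda>z. 1 / den z) \<odot> abs_L2 (poly N) = (\<Sum>k<m. coeff N k *\<^sub>L E (int k))"
    by (simp add: mul_sum mul_scale multiplier_inverse_den E_def)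
  moreover have "abs_L2 (\<lambda>z. C * (1 / den z * poly N z)) =
      C *\<^sub>L ((\<lambda>z. 1 / den z) \<odot> abs_L2 (poly N))"
    by (simp only: mul_abs_L2 scale_abs_L2 multiplier_inverse_den square_integrable_multiplier
        multiplier_poly multiplier_mult)
  ultimately show ?thesis
    by (auto intro!: L2.subspace_scale[OF subspace_model_space] L2.subspace_sum[OF subspace_model_space]
        E_in_model_space)
qed

text \<open>
  What the two kinds of kernels have in common. The function \<open>g\<close> may have a wrong value at the
  zero of $s z + t$; elsewhere it agrees with the quotient $C N / q$.
\<close>

lemma abs_L2_kernel:
  assumes g: "g \<in> borel_measurable borel"
    and g_eq: "\<And>z. norm z = 1 \<Longrightarrow> s * z + t \<noteq> 0 \<Longrightarrow> g z = (u * B z + v) / (s * z + t)"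
    and st: "s \<noteq> 0 \<or> t \<noteq> 0" and uv: "u \<noteq> 0 \<or> v \<noteq> 0"
    and N: "\<And>i. m \<le> i \<Longrightarrow> coeff N i = 0"
    and N_eq: "\<And>z. norm z = 1 \<Longrightarrow> u * B z + v = (s * z + t) * (C * (1 / den z * poly N z))"
  shows "abs_L2 g \<in> model_space B" and "abs_L2 g \<noteq> 0"
    and "\<And>k. 0 < k \<Longrightarrow> k < int m \<Longrightarrow>
      s * inner_L2 (abs_L2 g) (E (k - 1)) + t * inner_L2 (abs_L2 g) (E k) = 0"
proof -
  define h where "h = (\<lambda>z. C * (1 / den z * poly N z))"
  have h: "multiplier h"
    unfolding h_def by (intro multiplier_mult multiplier_const multiplier_inverse_den multiplier_poly)
  have "AE z in circle_measure. s * z + t \<noteq> 0"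
  proof (cases "s = 0")
    case False
    show ?thesis
      using AE_circle_neq[of "- t / s"] 
      by eventually_elim (use False in \<open>auto simp: field_simps eq_neg_iff_add_eq_0\<close>)
  qed (use st in auto)
  with AE_norm_eq_1 have "AE z in circle_measure. g z = h z"
    by eventually_elim (simp add: g_eq N_eq h_def)
  then have gh: "abs_L2 g = abs_L2 h"
    by (intro abs_L2_cong_AE(2) g square_integrable_multiplier h)
  show "abs_L2 g \<in> model_space B"
    unfolding gh h_def by (rule polynomial_over_den_in_model_space) (rule N)
  have \<zeta>0: "\<zeta> 0 = abs_L2 (\<lambda>z. 1)"
    by (simp add: character_def)
  have "(\<lambda>z. s * z + t) \<odot> abs_L2 g = abs_L2 (\<lambda>z. (s * z + t) * h z)"
    unfolding gh by (intro mul_abs_L2 multiplier_linear square_integrable_multiplier h)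
  also have "\<dots> = abs_L2 (\<lambda>z. u * B z + v * 1)"
    by (intro abs_L2_cong multiplier_add multiplier_mult multiplier_const multiplier_B
        multiplier_linear multiplier_ident h) (simp add: N_eq h_def)
  also have "\<dots> = abs_L2 (\<lambda>z. u * (B z * 1)) + abs_L2 (\<lambda>z. v * 1)"
    using plus_abs_L2[of "\<lambda>z. u * B z" "\<lambda>z. v * 1"]
      square_integrable_multiplier[OF multiplier_mult[OF multiplier_const multiplier_B], of u]
      square_integrable_multiplier[OF multiplier_const]
    by simp
  also have "\<dots> = u *\<^sub>L (B \<odot> \<zeta> 0) + v *\<^sub>L \<zeta> 0"
    unfolding \<zeta>0
    by (simp only: mul_abs_L2 scale_abs_L2 multiplier_B square_integrable_multiplier
        multiplier_const multiplier_mult)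
  finally have eq: "(\<lambda>z. s * z + t) \<odot> abs_L2 g = u *\<^sub>L (B \<odot> \<zeta> 0) + v *\<^sub>L \<zeta> 0" .
  show "abs_L2 g \<noteq> 0"
    by (rule linear_mul_nonzero[OF eq uv])
  show "s * inner_L2 (abs_L2 g) (E (k - 1)) + t * inner_L2 (abs_L2 g) (E k) = 0"
    if "0 < k" "k < int m" for k
    by (rule inner_E_recurrence[OF eq that])
qed

text \<open>
  Here $(1 - \overline{w} z) k_w = 1 - \overline{\alpha(w)} \alpha$, and $1 - \overline{w} z$ is split off
  with the factors $x_i = 1 - a_i \overline{w}$ and $y_i = \overline{w} - \overline{a_i}$, whose products are
  $\overline{q(w)}$ and $\overline{P(w)}$.
\<close>

lemma repr_kernel_recurrence:
  assumes w: "norm w \<le> 1"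
  shows "repr_kernel B w \<in> model_space B" and "repr_kernel B w \<noteq> 0"
    and "\<And>k. 0 < k \<Longrightarrow> k < int m \<Longrightarrow>
      inner_L2 (repr_kernel B w) (E k) = cnj w * inner_L2 (repr_kernel B w) (E (k - 1))"
proof -
  have factor: "(1 - cnj (a i) * z) * (1 - a i * cnj w) - (z - a i) * (cnj w - cnj (a i)) =
      (1 - a i * cnj (a i)) * (- cnj w * z + 1)" for i z
    by (simp add: algebra_simps)
  obtain N
    where N: "\<And>i. m \<le> i \<Longrightarrow> coeff N i = 0"
      and eq: "\<And>z. (\<Prod>i<m. (1 - cnj (a i) * z)) * (\<Prod>i<m. 1 - a i * cnj w) -
          (\<Prod>i<m. (z - a i)) * (\<Prod>i<m. cnj w - cnj (a i)) = (- cnj w * z + 1) * poly N z"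
    using bezoutian[where m = m and a = a, OF factor] by blast
  have eq: "den z * cnj (den w) - num z * cnj (num w) = (- cnj w * z + 1) * poly N z" for z
    using eq[of z] by (simp add: den_def num_def)
  have meas: "(\<lambda>z. (1 - cnj (B w) * B z) / (1 - cnj w * z)) \<in> borel_measurable borel"
    using multiplier_measurable[OF multiplier_B] by measurable
  have eq': "(1 - cnj (B w) * B z) / (1 - cnj w * z) = (- cnj (B w) * B z + 1) / (- cnj w * z + 1)"
    for z
    by simp
  have st: "- cnj w \<noteq> 0 \<or> (1::complex) \<noteq> 0" and uv: "- cnj (B w) \<noteq> 0 \<or> (1::complex) \<noteq> 0"
    by simp_all
  have "- cnj (B w) * B z + 1 = (- cnj w * z + 1) * (1 / cnj (den w) * (1 / den z * poly N z))"
    if "norm z = 1" for z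
  proof -
    have cc: "c * cnj c = 1"
      using norm_c complex_norm_square[of c] by simp
    have nz: "den z \<noteq> 0" "cnj (den w) \<noteq> 0"
      using den_nonzero[of z] den_nonzero[of w] that w by auto
    have "- cnj (B w) * B z + 1 = 1 - (c * cnj c) * (cnj (num w) * num z) / (cnj (den w) * den z)"
      by (simp add: B_def)
    also have "\<dots> = (den z * cnj (den w) - num z * cnj (num w)) / (cnj (den w) * den z)"
      unfolding cc using nz by (simp add: diff_divide_distrib mult.commute)
    also have "\<dots> = (- cnj w * z + 1) * poly N z / (cnj (den w) * den z)"
      by (simp only: eq)
    finally show ?thesis
      by simp
  qed
  note kernel = abs_L2_kernel[OF meas eq' st uv N this]
  show "repr_kernel B w \<in> model_space B"
    unfolding repr_kernel_def by (rule kernel(1))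
  show "repr_kernel B w \<noteq> 0"
    unfolding repr_kernel_def by (rule kernel(2))
  show "inner_L2 (repr_kernel B w) (E k) = cnj w * inner_L2 (repr_kernel B w) (E (k - 1))"
    if "0 < k" "k < int m" for k
  proof -
    have "- cnj w * inner_L2 (repr_kernel B w) (E (k - 1)) + 1 * inner_L2 (repr_kernel B w) (E k) = 0"
      unfolding repr_kernel_def by (rule kernel(3)[OF _ _ that])
    then show ?thesis
      by simp
  qed
qed

text \<open>
  Here $(z - w) \widetilde{k}_w = \alpha - \alpha(w)$, and $z - w$ is split off with the factors
  $x_i = w - a_i$ and $y_i = 1 - \overline{a_i} w$, whose products are $P(w)$ and $q(w)$.
\<close>

lemma conj_kernel_recurrence:
  assumes w: "norm w \<le> 1"
  shows "conj_kernel B w \<in> model_space B" and "conj_kernel B w \<noteq> 0"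
    and "\<And>k. 0 < k \<Longrightarrow> k < int m \<Longrightarrow>
      inner_L2 (conj_kernel B w) (E (k - 1)) = w * inner_L2 (conj_kernel B w) (E k)"
proof -
  have factor: "(1 - cnj (a i) * z) * (w - a i) - (z - a i) * (1 - cnj (a i) * w) =
      (a i * cnj (a i) - 1) * (1 * z + - w)" for i z
    by (simp add: algebra_simps)
  obtain N
    where N: "\<And>i. m \<le> i \<Longrightarrow> coeff N i = 0"
      and eq: "\<And>z. (\<Prod>i<m. (1 - cnj (a i) * z)) * (\<Prod>i<m. w - a i) -
          (\<Prod>i<m. (z - a i)) * (\<Prod>i<m. 1 - cnj (a i) * w) = (1 * z + - w) * poly N z"
    using bezoutian[where m = m and a = a, OF factor] by blast
  have eq: "den z * num w - num z * den w = (1 * z + - w) * poly N z" for z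
    using eq[of z] unfolding den_def num_def .
  have meas: "(\<lambda>z. (B z - B w) / (z - w)) \<in> borel_measurable borel"
    using multiplier_measurable[OF multiplier_B] by measurable
  have eq': "(B z - B w) / (z - w) = (1 * B z + - B w) / (1 * z + - w)" for z
    by simp
  have st: "(1::complex) \<noteq> 0 \<or> - w \<noteq> 0" and uv: "(1::complex) \<noteq> 0 \<or> - B w \<noteq> 0"
    by simp_all
  have "1 * B z + - B w = (1 * z + - w) * (- c / den w * (1 / den z * poly N z))"
    if "norm z = 1" for z
  proof -
    have nz: "den z \<noteq> 0" "den w \<noteq> 0"
      using den_nonzero[of z] den_nonzero[of w] that w by auto
    then have "1 * B z + - B w = (- c) * (den z * num w - num z * den w) / (den w * den z)"
      by (simp add: B_def field_simps)
    then show ?thesis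
      unfolding eq by (simp add: mult_ac)
  qed
  note kernel = abs_L2_kernel[OF meas eq' st uv N this]
  show "conj_kernel B w \<in> model_space B"
    unfolding conj_kernel_def by (rule kernel(1))
  show "conj_kernel B w \<noteq> 0"
    unfolding conj_kernel_def by (rule kernel(2))
  show "inner_L2 (conj_kernel B w) (E (k - 1)) = w * inner_L2 (conj_kernel B w) (E k)"
    if "0 < k" "k < int m" for k
  proof -
    have "1 * inner_L2 (conj_kernel B w) (E (k - 1)) + - w * inner_L2 (conj_kernel B w) (E k) = 0"
      unfolding conj_kernel_def by (rule kernel(3)[OF _ _ that])
    then show ?thesis
      by simp
  qed
qed

text \<open>
  The recurrence determines the coefficients up to a factor, and this factor is not zero because a
  vector of the model space that is orthogonal to the basis vanishes.
\<close>

lemma repr_kernel_coefficients: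
  assumes w: "norm w \<le> 1"
  obtains X where "X \<noteq> 0" "\<And>k. k < m \<Longrightarrow> inner_L2 (repr_kernel B w) (E (int k)) = X * cnj w ^ k"
proof -
  define X where "X = inner_L2 (repr_kernel B w) (E 0)"
  have eq: "inner_L2 (repr_kernel B w) (E (int k)) = X * cnj w ^ k" if "k < m" for k
    using that
  proof (induct k)
    case (Suc k)
    then show ?case
      using repr_kernel_recurrence(3)[OF w, of "int (Suc k)"] by simp
  qed (simp add: X_def)
  have "X \<noteq> 0"
  proof
    assume "X = 0"
    have "inner_L2 (repr_kernel B w) (E k) = 0" if "0 \<le> k" "k < int m" for k
      using eq[of "nat k"] that \<open>X = 0\<close> by simp
    then have "repr_kernel B w = 0"
      by (rule model_space_orthogonal_eq_0[OF repr_kernel_recurrence(1)[OF w]])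
    then show False
      using repr_kernel_recurrence(2)[OF w] by simp
  qed
  then show ?thesis
    using eq that by blast
qed

lemma conj_kernel_coefficients:
  assumes w: "norm w \<le> 1"
  obtains Y where "Y \<noteq> 0" "\<And>k. k < m \<Longrightarrow> inner_L2 (conj_kernel B w) (E (int (m - 1 - k))) = Y * w ^ k"
proof -
  define Y where "Y = inner_L2 (conj_kernel B w) (E (int (m - 1)))"
  have eq: "inner_L2 (conj_kernel B w) (E (int (m - 1 - k))) = Y * w ^ k" if "k < m" for k
    using that
  proof (induct k)
    case (Suc k)
    then have "int (m - 1 - Suc k) = int (m - 1 - k) - 1"
      by linarith
    then have "inner_L2 (conj_kernel B w) (E (int (m - 1 - Suc k))) =
        w * inner_L2 (conj_kernel B w) (E (int (m - 1 - k)))"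
      using Suc.prems by (simp only:) (intro conj_kernel_recurrence(3)[OF w], auto)
    also have "\<dots> = w * (Y * w ^ k)"
      using Suc by (simp only: Suc_lessD)
    finally show ?case
      by (simp only: power_Suc mult.left_commute)
  qed (simp add: Y_def)
  have "Y \<noteq> 0"
  proof
    assume "Y = 0"
    have "inner_L2 (conj_kernel B w) (E k) = 0" if "0 \<le> k" "k < int m" for k
    proof -
      have "m - 1 - (m - 1 - nat k) = nat k"
        using that by linarith
      then show ?thesis
        using eq[of "m - 1 - nat k"] that \<open>Y = 0\<close> degree_pos by simp
    qed
    then have "conj_kernel B w = 0"
      by (rule model_space_orthogonal_eq_0[OF conj_kernel_recurrence(1)[OF w]])
    then show False
      using conj_kernel_recurrence(2)[OF w] by simp
  qed
  then show ?thesis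
    using eq that by blast
qed

lemma inner_E_repr_kernel:
  assumes w: "norm w \<le> 1"
  obtains X where "X \<noteq> 0" "\<And>i. i < m \<Longrightarrow> inner_L2 (E (int i)) (repr_kernel B w) = X * w ^ i"
proof -
  obtain X where X: "X \<noteq> 0" "\<And>k. k < m \<Longrightarrow> inner_L2 (repr_kernel B w) (E (int k)) = X * cnj w ^ k"
    using repr_kernel_coefficients[OF w] by blast
  have "inner_L2 (E (int i)) (repr_kernel B w) = cnj X * w ^ i" if "i < m" for i
    using X(2)[OF that] inner_commute[of "E (int i)" "repr_kernel B w"] by simp
  then show ?thesis
    using X(1) that[of "cnj X"] by simp
qed

lemma inner_E_conj_kernel:
  assumes w: "norm w \<le> 1"
  obtains Y where "Y \<noteq> 0"
    "\<And>i. i < m \<Longrightarrow> inner_L2 (E (int i)) (conj_kernel B w) = Y * cnj w ^ (m - 1 - i)"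
proof -
  obtain Y where Y: "Y \<noteq> 0"
    "\<And>k. k < m \<Longrightarrow> inner_L2 (conj_kernel B w) (E (int (m - 1 - k))) = Y * w ^ k"
    using conj_kernel_coefficients[OF w] by blast
  have "inner_L2 (E (int i)) (conj_kernel B w) = cnj Y * cnj w ^ (m - 1 - i)" if "i < m" for i
  proof -
    have idx: "m - 1 - i < m" "m - 1 - (m - 1 - i) = i"
      using that by linarith+
    have "inner_L2 (conj_kernel B w) (E (int i)) = Y * w ^ (m - 1 - i)"
      using Y(2)[OF idx(1)] unfolding idx(2) .
    then show ?thesis
      using inner_commute[of "E (int i)" "conj_kernel B w"] by simp
  qed
  then show ?thesis
    using Y(1) that[of "cnj Y"] by simp
qed

end

section \<open>Orthogonal projection onto a model space\<close>

text \<open>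
  Gram-Schmidt: a new vector \<open>b\<close> is first replaced by its component \<open>e\<close> orthogonal to the
  span of the others.
\<close>

lemma orthogonal_decomposition_span:
  assumes "finite S"
  shows "\<exists>h\<in>L2.span S. \<forall>g\<in>L2.span S. inner_L2 (x - h) g = 0"
  using assms
proof (induct S arbitrary: x rule: finite_induct)
  case empty
  show ?case
    by simp
next
  case (insert b S)
  obtain b\<^sub>0 where b\<^sub>0: "b\<^sub>0 \<in> L2.span S" "\<And>g. g \<in> L2.span S \<Longrightarrow> inner_L2 (b - b\<^sub>0) g = 0"
    using insert(3)[of b] by blast
  obtain h\<^sub>0 where h\<^sub>0: "h\<^sub>0 \<in> L2.span S" "\<And>g. g \<in> L2.span S \<Longrightarrow> inner_L2 (x - h\<^sub>0) g = 0"
    using insert(3)[of x] by blast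
  define e where "e = b - b\<^sub>0"
  have e_orth: "inner_L2 e g = 0" if "g \<in> L2.span S" for g
    using b\<^sub>0(2)[OF that] by (simp add: e_def)
  show ?case
  proof (cases "e = 0")
    case True
    then have "b = b\<^sub>0"
      by (simp add: e_def)
    then have "L2.span (insert b S) = L2.span S"
      using b\<^sub>0(1) by (simp add: L2.span_redundant)
    then show ?thesis
      using h\<^sub>0 by auto
  next
    case False
    define r where "r = inner_L2 x e / inner_L2 e e"
    have r: "r * inner_L2 e e = inner_L2 x e"
      using False by (simp add: r_def inner_self_eq_0_iff)
    have sub: "y \<in> L2.span (insert b S)" if "y \<in> L2.span S" for y
      using that L2.span_mono[of S "insert b S"] by auto
    have "e \<in> L2.span (insert b S)"
      unfolding e_def by (intro L2.span_diff L2.span_base sub b\<^sub>0) simp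
    then have "h\<^sub>0 + r *\<^sub>L e \<in> L2.span (insert b S)"
      by (intro L2.span_add[OF sub[OF h\<^sub>0(1)]] L2.span_scale)
    moreover have "inner_L2 (x - (h\<^sub>0 + r *\<^sub>L e)) g = 0" if g_in: "g \<in> L2.span (insert b S)" for g
    proof -
      obtain k where "g - k *\<^sub>L b \<in> L2.span S"
        using g_in L2.span_breakdown_eq by blast
      then have "g - k *\<^sub>L b + k *\<^sub>L b\<^sub>0 \<in> L2.span S"
        by (intro L2.span_add L2.span_scale b\<^sub>0)
      moreover define g\<^sub>1 where "g\<^sub>1 = g - k *\<^sub>L b + k *\<^sub>L b\<^sub>0"
      ultimately have g\<^sub>1: "g\<^sub>1 \<in> L2.span S"
        by simp
      have g: "g = g\<^sub>1 + k *\<^sub>L e"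
        by (simp add: g\<^sub>1_def e_def L2.scale_right_diff_distrib)
      have "inner_L2 (x - (h\<^sub>0 + r *\<^sub>L e)) g\<^sub>1 = 0"
        using h\<^sub>0(2)[OF g\<^sub>1] e_orth[OF g\<^sub>1]
        by (simp add: inner_diff_left inner_add_left inner_scale_left)
      moreover have "inner_L2 (x - (h\<^sub>0 + r *\<^sub>L e)) e = 0"
        using e_orth[OF h\<^sub>0(1)] inner_commute[of h\<^sub>0 e] r
        by (simp add: inner_diff_left inner_add_left inner_scale_left)
      ultimately show ?thesis
        by (simp add: g inner_add_right inner_scale_right)
    qed
    ultimately show ?thesis
      by blast
  qed
qed

lemma orth_proj_properties:
  assumes K: "L2.subspace K" and ex: "\<exists>h\<in>K. \<forall>g\<in>K. inner_L2 (x - h) g = 0"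
  shows "orth_proj K x \<in> K" and "\<And>g. g \<in> K \<Longrightarrow> inner_L2 (orth_proj K x) g = inner_L2 x g"
proof -
  have "\<exists>!h. h \<in> K \<and> (\<forall>g\<in>K. inner_L2 (x - h) g = 0)"
  proof (rule ex_ex1I)
    show "\<exists>h. h \<in> K \<and> (\<forall>g\<in>K. inner_L2 (x - h) g = 0)"
      using ex by blast
    fix h h'
    assume h: "h \<in> K \<and> (\<forall>g\<in>K. inner_L2 (x - h) g = 0)"
      and h': "h' \<in> K \<and> (\<forall>g\<in>K. inner_L2 (x - h') g = 0)"
    then have "h - h' \<in> K"
      by (intro L2.subspace_diff[OF K]) auto
    then have "inner_L2 (x - h') (h - h') - inner_L2 (x - h) (h - h') = 0"
      using h h' by simp
    then have "inner_L2 (h - h') (h - h') = 0"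
      by (simp add: inner_diff_left)
    then show "h = h'"
      by (simp add: inner_self_eq_0_iff)
  qed
  from theI'[OF this] have P: "orth_proj K x \<in> K \<and> (\<forall>g\<in>K. inner_L2 (x - orth_proj K x) g = 0)"
    unfolding orth_proj_def .
  then show "orth_proj K x \<in> K"
    by simp
  show "inner_L2 (orth_proj K x) g = inner_L2 x g" if "g \<in> K" for g
    using P that by (simp add: inner_diff_left)
qed

text \<open>
  The hypothesis says that $x - p$ is orthogonal to $p$.
\<close>

lemma norm_L2_le_of_inner_eq:
  assumes "inner_L2 p p = inner_L2 x p"
  shows "norm_L2 p \<le> norm_L2 x"
proof -
  have "0 \<le> Re (inner_L2 (x - p) (x - p))"
    by (rule inner_self_nonneg)
  moreover have "inner_L2 p x = cnj (inner_L2 p p)"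
    using assms inner_commute[of p x] by simp
  ultimately show ?thesis
    using assms by (simp add: norm_L2_def inner_diff_left inner_diff_right)
qed

lemma subspace_multipliers: "L2.subspace {x. \<exists>u. multiplier u \<and> x = abs_L2 u}"
proof (rule L2.subspaceI)
  show "0 \<in> {x. \<exists>u. multiplier u \<and> x = abs_L2 u}"
    using multiplier_const[of 0] by (auto simp: zero_L2_def)
next
  fix x y assume "x \<in> {x. \<exists>u. multiplier u \<and> x = abs_L2 u}" "y \<in> {x. \<exists>u. multiplier u \<and> x = abs_L2 u}"
  then obtain u v where "multiplier u" "x = abs_L2 u" "multiplier v" "y = abs_L2 v"
    by blast
  then show "x + y \<in> {x. \<exists>u. multiplier u \<and> x = abs_L2 u}"
    using multiplier_add[of u v] plus_abs_L2[of u v] square_integrable_multiplier by blast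
next
  fix c x assume "x \<in> {x. \<exists>u. multiplier u \<and> x = abs_L2 u}"
  then obtain u where "multiplier u" "x = abs_L2 u"
    by blast
  then show "c *\<^sub>L x \<in> {x. \<exists>u. multiplier u \<and> x = abs_L2 u}"
    using multiplier_mult[OF multiplier_const, of u c] scale_abs_L2[of u c] square_integrable_multiplier
    by blast
qed

text \<open>
  The symbol is only square integrable, so multiplication by it has no adjoint on all of $L^2$. Against
  a fixed bounded function $v$ one can take $G = \overline{\varphi} v$. The lemma serves to show that
  $\langle \varphi f, v \rangle$ is linear in $f$ on the model space.
\<close>

lemma mult_L2_adjoint:
  assumes v: "multiplier v"
  obtains G where "\<And>u. multiplier u \<Longrightarrow> inner_L2 (mult_L2 \<phi> (abs_L2 u)) (abs_L2 v) = inner_L2 (abs_L2 u) G"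
proof (rule abs_L2_cases[of \<phi>])
  fix f assume f: "square_integrable f" and \<phi>: "\<phi> = abs_L2 f"
  have cnj_f: "square_integrable (\<lambda>z. cnj (f z))"
  proof -
    have "(\<lambda>z. cnj (f z)) \<in> borel_measurable circle_measure"
      using square_integrable_measurable[OF f] by measurable
    moreover have "integrable circle_measure (\<lambda>z. (norm (cnj (f z)))\<^sup>2)"
      using f by (simp add: square_integrable_def)
    ultimately show ?thesis
      unfolding square_integrable_def by blast
  qed
  have "inner_L2 (mult_L2 \<phi> (abs_L2 u)) (abs_L2 v) = inner_L2 (abs_L2 u) (v \<odot> abs_L2 (\<lambda>z. cnj (f z)))"
    if u: "multiplier u" for u
  proof -
    have "mult_L2 \<phi> (abs_L2 u) = abs_L2 (\<lambda>z. u z * f z)"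
      unfolding \<phi> by (subst mult_L2_commute) (rule mul_abs_L2[OF u f])
    then show ?thesis
      using inner_abs_L2[OF square_integrable_mult[OF u f] square_integrable_multiplier[OF v]]
        inner_abs_L2[OF square_integrable_multiplier[OF u] square_integrable_mult[OF v cnj_f]]
        mul_abs_L2[OF v cnj_f]
      by (simp add: mult_ac)
  qed
  then show ?thesis
    by (rule that)
qed

lemma mul_cnj_character: "(\<lambda>z. cnj (z powi j)) \<odot> \<zeta> k = \<zeta> (k - j)"
proof -
  have "abs_L2 (\<lambda>z. cnj (z powi j)) = abs_L2 (\<lambda>z. z powi (- j))"
    by (intro abs_L2_cong multiplier_cnj multiplier_power_int)
      (simp add: cnj_eq_inverse power_int_inverse power_int_minus)
  then show ?thesis
    by (simp add: mul_character)
qed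

context blaschke
begin

lemma orth_proj_model_space:
  shows "orth_proj (model_space B) x \<in> model_space B"
    and "g \<in> model_space B \<Longrightarrow> inner_L2 (orth_proj (model_space B) x) g = inner_L2 x g"
proof -
  have "\<exists>h\<in>model_space B. \<forall>g\<in>model_space B. inner_L2 (x - h) g = 0"
    unfolding model_space_eq_span by (rule orthogonal_decomposition_span) simp
  from orth_proj_properties[OF subspace_model_space this]
  show "orth_proj (model_space B) x \<in> model_space B"
    and "g \<in> model_space B \<Longrightarrow> inner_L2 (orth_proj (model_space B) x) g = inner_L2 x g" .
qed

lemma E_eq_abs_L2: "E k = abs_L2 (\<lambda>z. 1 / den z * z powi k)"
  unfolding E_def character_def
  by (intro mul_abs_L2 multiplier_inverse_den square_integrable_multiplier multiplier_power_int)

lemma multiplier_E: "multiplier (\<lambda>z. 1 / den z * z powi k)"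
  by (intro multiplier_mult multiplier_inverse_den multiplier_power_int)

lemma model_space_multiplier:
  assumes "x \<in> model_space B"
  obtains u where "multiplier u" "x = abs_L2 u"
proof -
  have "L2.span (E ` {0..<int m}) \<subseteq> {x. \<exists>u. multiplier u \<and> x = abs_L2 u}"
    by (rule L2.span_minimal[OF _ subspace_multipliers]) (use E_eq_abs_L2 multiplier_E in blast)
  then show ?thesis
    using assms that unfolding model_space_eq_span by blast
qed

end

section \<open>Operators of rank one and Hankel matrices of rank one\<close>

lemma rank_on_eq_1_iff:
  "rank_on K A = 1 \<longleftrightarrow> (\<exists>f\<in>K. A f \<noteq> 0 \<and> (\<forall>g\<in>K. \<exists>t. A g = t *\<^sub>L A f))"
proof
  assume "rank_on K A = 1"
  then obtain S where S: "S \<subseteq> A ` K" "L2.independent S" "A ` K \<subseteq> L2.span S" "card S = 1"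
    using L2.basis_exists[of "A ` K"] unfolding rank_on_def by metis
  then obtain v where v: "S = {v}"
    by (auto simp: card_1_singleton_iff)
  then have "v \<noteq> 0"
    using S(2) L2.dependent_zero[of S] by auto
  moreover obtain f where "f \<in> K" "v = A f"
    using S(1) v by auto
  moreover have "\<exists>t. A g = t *\<^sub>L v" if "g \<in> K" for g
    using S(3) that v by (auto simp: L2.span_singleton)
  ultimately show "\<exists>f\<in>K. A f \<noteq> 0 \<and> (\<forall>g\<in>K. \<exists>t. A g = t *\<^sub>L A f)"
    by blast
next
  assume "\<exists>f\<in>K. A f \<noteq> 0 \<and> (\<forall>g\<in>K. \<exists>t. A g = t *\<^sub>L A f)"
  then obtain f where f: "f \<in> K" "A f \<noteq> 0" "\<And>g. g \<in> K \<Longrightarrow> \<exists>t. A g = t *\<^sub>L A f"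
    by blast
  have "A ` K \<subseteq> L2.span {A f}"
    using f(3) by (auto simp: L2.span_singleton)
  moreover have "L2.independent {A f}"
    using f(2) L2.independent_insert[of "A f" "{}"] by (simp add: L2.span_empty)
  ultimately show "rank_on K A = 1"
    unfolding rank_on_def using f(1) by (intro L2.dim_unique[of "{A f}"]) auto
qed

lemma rank_on_eq_1I:
  assumes f: "f \<in> K" "A f \<noteq> 0" and range: "\<And>g. g \<in> K \<Longrightarrow> \<exists>t. A g = t *\<^sub>L v"
  shows "rank_on K A = 1"
proof -
  obtain r where r: "A f = r *\<^sub>L v"
    using range[OF f(1)] by blast
  then have "r \<noteq> 0"
    using f(2) by auto
  have "\<exists>t. A g = t *\<^sub>L A f" if g: "g \<in> K" for g
  proof -
    obtain t where "A g = t *\<^sub>L v"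
      using range[OF g] by blast
    then have "A g = (t / r) *\<^sub>L A f"
      using \<open>r \<noteq> 0\<close> by (simp add: r)
    then show ?thesis ..
  qed
  then show ?thesis
    unfolding rank_on_eq_1_iff using f by blast
qed

text \<open>
  At the first nonzero entry of $x$, the relation $x_{i+1} y_j = x_i y_{j+1}$ shows that all entries of
  $y$ but the last vanish, and then the same relation with the last entry of $y$ kills all entries of
  $x$ but the last. If $n = 1$, then $m \le 2$ and only $x_0 = 0$ is claimed. In terms of ratios, this
  is the point $\infty$ of the Riemann sphere.
\<close>

lemma rank_one_Hankel_vanishing:
  fixes x y :: "nat \<Rightarrow> complex"
  assumes shift: "\<And>i j. Suc i < m \<Longrightarrow> Suc j < n \<Longrightarrow> x (Suc i) * y j = x i * y (Suc j)"
    and x: "\<exists>i<m. x i \<noteq> 0" and y: "\<exists>j<n. y j \<noteq> 0"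
    and x0: "x 0 = 0" and mn: "m * n \<le> 2 \<or> (m > 1 \<and> n > 1)"
  shows "(\<forall>i<m - 1. x i = 0) \<and> (\<forall>j<n - 1. y j = 0)"
proof (cases "n > 1")
  case False
  then have "n = 1"
    using y by (cases n) auto
  then have "m \<le> 2"
    using mn by auto
  then have "i = 0" if "i < m - 1" for i
    using that by linarith
  then show ?thesis
    using x0 \<open>n = 1\<close> by auto
next
  case True
  define i\<^sub>0 where "i\<^sub>0 = (LEAST i. x i \<noteq> 0)"
  obtain i\<^sub>1 where i\<^sub>1: "i\<^sub>1 < m" "x i\<^sub>1 \<noteq> 0"
    using x by blast
  have "x i\<^sub>0 \<noteq> 0"
    unfolding i\<^sub>0_def by (rule LeastI, rule i\<^sub>1(2))
  moreover have "i\<^sub>0 < m"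
    using Least_le[of "\<lambda>i. x i \<noteq> 0", OF i\<^sub>1(2)] i\<^sub>1(1) unfolding i\<^sub>0_def by linarith
  moreover have "i\<^sub>0 \<noteq> 0"
    using x0 \<open>x i\<^sub>0 \<noteq> 0\<close> by metis
  ultimately obtain k where k: "i\<^sub>0 = Suc k" "x (Suc k) \<noteq> 0" "Suc k < m"
    using not0_implies_Suc by metis
  have "x k = 0"
    using not_less_Least[of k "\<lambda>i. x i \<noteq> 0"] k(1) unfolding i\<^sub>0_def by simp
  have y_zero: "y j = 0" if "j < n - 1" for j
    using shift[of k j] that k \<open>x k = 0\<close> by simp
  obtain l where l: "n = Suc (Suc l)"
    using True by (cases n; cases "n - 1") auto
  have "y (Suc l) \<noteq> 0"
  proof
    assume "y (Suc l) = 0"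
    then have "y j = 0" if "j < n" for j
      using y_zero[of j] that l by (cases "j = Suc l") auto
    then show False
      using y by blast
  qed
  moreover have "x (Suc i) * y l = x i * y (Suc l)" if "i < m - 1" for i
    using that l by (intro shift) auto
  moreover have "y l = 0"
    using l by (intro y_zero) simp
  ultimately have "x i = 0" if "i < m - 1" for i
    using that by (metis mult_eq_0_iff)
  then show ?thesis
    using y_zero by blast
qed

text \<open>
  A geometric progression of ratio $w$, read backwards, has ratio $1 / w$.
\<close>

lemma geometric_reverse:
  fixes x :: "nat \<Rightarrow> complex"
  assumes "\<And>i. i < m \<Longrightarrow> x i = s * w ^ i" and "w \<noteq> 0" and "i < m"
  shows "x i = (s * w ^ (m - 1)) * (1 / w) ^ (m - 1 - i)"
proof -
  have "w ^ (m - 1) = w ^ i * w ^ (m - 1 - i)"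
    using assms(3) by (simp flip: power_add)
  then have "w ^ (m - 1) * (1 / w) ^ (m - 1 - i) = w ^ i"
    using assms(2) by (simp add: power_one_over)
  then show ?thesis
    using assms(1)[OF assms(3)] by (simp only: mult.assoc)
qed

text \<open>
  A progression concentrated in its last entry is geometric of ratio $0$ when read backwards, with
  the convention \<open>0 ^ 0 = 1\<close>.
\<close>

lemma geometric_last:
  fixes x :: "nat \<Rightarrow> complex"
  assumes "\<forall>i<m - 1. x i = 0" and "i < m"
  shows "x i = x (m - 1) * 0 ^ (m - 1 - i)"
proof (cases "i < m - 1")
  case False
  then have "i = m - 1"
    using assms(2) by linarith
  then show ?thesis
    by simp
next
  case True
  then show ?thesis
    using assms(1) by (cases "m - 1 - i") auto
qed

text \<open>
  If the first entries do not vanish, $x_{i+1} y_0 = x_i y_1$ and $x_1 y_j = x_0 y_{j+1}$ force the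
  common ratio $x_1 / x_0 = y_1 / y_0$. When one of the factors has length $1$ there is no such
  relation, but then the other one has length at most $2$ and is geometric with the obvious ratio.
  A ratio outside the unit disk is turned into one inside it by reversing both progressions.
\<close>

lemma rank_one_Hankel:
  fixes x y h :: "nat \<Rightarrow> complex"
  assumes hankel: "\<And>i j. i < m \<Longrightarrow> j < n \<Longrightarrow> x i * y j = h (i + j)"
    and x: "\<exists>i<m. x i \<noteq> 0" and y: "\<exists>j<n. y j \<noteq> 0"
    and mn: "m * n \<le> 2 \<or> (m > 1 \<and> n > 1)"
  obtains (disk) w s t where "norm w \<le> 1" "s \<noteq> 0" "t \<noteq> 0"
      "\<And>i. i < m \<Longrightarrow> x i = s * w ^ i" "\<And>j. j < n \<Longrightarrow> y j = t * w ^ j"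
  | (exterior) w s t where "norm w \<le> 1" "s \<noteq> 0" "t \<noteq> 0"
      "\<And>i. i < m \<Longrightarrow> x i = s * w ^ (m - 1 - i)" "\<And>j. j < n \<Longrightarrow> y j = t * w ^ (n - 1 - j)"
proof -
  have shift: "x (Suc i) * y j = x i * y (Suc j)" if "Suc i < m" "Suc j < n" for i j
    using hankel[of "Suc i" j] hankel[of i "Suc j"] that by simp
  have shift': "y (Suc j) * x i = y j * x (Suc i)" if "Suc j < n" "Suc i < m" for i j
    using shift[OF that(2,1)] by (simp only: mult.commute)
  show thesis
  proof (cases "x 0 = 0 \<or> y 0 = 0")
    case True
    have "(\<forall>i<m - 1. x i = 0) \<and> (\<forall>j<n - 1. y j = 0)"
      using True
    proof
      assume "x 0 = 0"
      then show ?thesis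
        using rank_one_Hankel_vanishing[of m n x y, OF shift x y _ mn] by blast
    next
      assume "y 0 = 0"
      then show ?thesis
        using rank_one_Hankel_vanishing[of n m y x, OF shift' y x] mn by (simp add: mult.commute conj_commute)
    qed
    then have zero: "\<forall>i<m - 1. x i = 0" "\<forall>j<n - 1. y j = 0"
      by auto
    obtain i j where "i < m" "x i \<noteq> 0" "j < n" "y j \<noteq> 0"
      using x y by blast
    then have "x (m - 1) \<noteq> 0" "y (n - 1) \<noteq> 0"
      using geometric_last[OF zero(1) \<open>i < m\<close>] geometric_last[OF zero(2) \<open>j < n\<close>] by auto
    moreover have "norm (0::complex) \<le> 1"
      by simp
    ultimately show thesis
      using exterior geometric_last[OF zero(1)] geometric_last[OF zero(2)] by blast
  next
    case False
    define w where "w = (if m > 1 then x 1 / x 0 else if n > 1 then y 1 / y 0 else 0)"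
    have x1: "x 1 = w * x 0" if "m > 1"
      using that False by (simp add: w_def)
    have y1: "y 1 = w * y 0" if "n > 1"
    proof (cases "m > 1")
      case True
      then show ?thesis
        using shift[of 0 0] that False x1 by simp
    qed (use that False in \<open>simp add: w_def\<close>)
    have "x (Suc i) = w * x i" if i: "Suc i < m" for i
    proof (cases "n > 1")
      case True
      then have "x (Suc i) * y 0 = (w * x i) * y 0"
        using shift[of i 0] i y1 by (simp add: mult_ac)
      then show ?thesis
        using False by simp
    next
      case n: False
      then have "n = 1"
        using y by (cases n) auto
      then have "i = 0" "m > 1"
        using mn i by auto
      then show ?thesis
        using x1 by simp
    qed
    then have xw: "x i = x 0 * w ^ i" if "i < m" for i
      using that
    proof (induct i)
      case (Suc i)
      then have "x (Suc i) = w * (x 0 * w ^ i)"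
        by (metis Suc_lessD)
      then show ?case
        by simp
    qed simp
    have "y (Suc j) = w * y j" if j: "Suc j < n" for j
    proof (cases "m > 1")
      case True
      then have "y (Suc j) * x 0 = (w * y j) * x 0"
        using shift'[of j 0] j x1 by (simp add: mult_ac)
      then show ?thesis
        using False by simp
    next
      case m: False
      then have "m = 1"
        using x by (cases m) auto
      then have "j = 0" "n > 1"
        using mn j by auto
      then show ?thesis
        using y1 by simp
    qed
    then have yw: "y j = y 0 * w ^ j" if "j < n" for j
      using that
    proof (induct j)
      case (Suc j)
      then have "y (Suc j) = w * (y 0 * w ^ j)"
        by (metis Suc_lessD)
      then show ?case
        by simp
    qed simp
    show thesis
    proof (cases "norm w \<le> 1")
      case True
      then show thesis
        by (rule disk[of w "x 0" "y 0"]) (use False xw yw in blast)+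
    next
      case w: False
      then have "w \<noteq> 0"
        by auto
      have "norm (1 / w) \<le> 1"
        using w by (simp add: norm_divide divide_le_eq_1)
      moreover have "x 0 * w ^ (m - 1) \<noteq> 0" "y 0 * w ^ (n - 1) \<noteq> 0"
        using False \<open>w \<noteq> 0\<close> by auto
      ultimately show thesis
        using exterior geometric_reverse[of m x "x 0" w, OF xw \<open>w \<noteq> 0\<close>]
          geometric_reverse[of n y "y 0" w, OF yw \<open>w \<noteq> 0\<close>] by blast
    qed
  qed
qed

section \<open>The Hankel matrix of an asymmetric truncated Toeplitz operator\<close>

locale blaschke_pair = dom: blaschke c a m + cod: blaschke d b n
  for c :: complex and a :: "nat \<Rightarrow> complex" and m :: nat
    and d :: complex and b :: "nat \<Rightarrow> complex" and n :: nat
begin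

lemma attoeplitz_model_space:
  assumes "f \<in> model_space dom.B"
  shows "attoeplitz dom.B cod.B \<phi> f \<in> model_space cod.B"
    and "g \<in> model_space cod.B \<Longrightarrow>
      inner_L2 (attoeplitz dom.B cod.B \<phi> f) g = inner_L2 (mult_L2 \<phi> f) g"
  using assms by (simp_all add: attoeplitz_def cod.orth_proj_model_space)

text \<open>
  The source of the Hankel structure: $e_i \overline{f_l}$ depends on $i$ and $l$ through the factor
  $z^i \overline{z}^l = z^{i-l}$ only.
\<close>

lemma inner_mult_E:
  "inner_L2 (mult_L2 \<phi> (dom.E i)) (cod.E l) =
    inner_L2 \<phi> ((\<lambda>z. cnj (1 / dom.den z) * (1 / cod.den z)) \<odot> \<zeta> (l - i))"
proof -
  have "inner_L2 (mult_L2 \<phi> (dom.E i)) (cod.E l) =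
      inner_L2 ((\<lambda>z. 1 / dom.den z * z powi i) \<odot> \<phi>) (cod.E l)"
    by (simp only: mult_L2_commute[of \<phi>] dom.E_eq_abs_L2)
  also have "\<dots> = inner_L2 \<phi> ((\<lambda>z. cnj (1 / dom.den z * z powi i)) \<odot> cod.E l)"
    by (rule inner_mul_left) (rule dom.multiplier_E)
  also have "(\<lambda>z. cnj (1 / dom.den z * z powi i)) \<odot> cod.E l =
      (\<lambda>z. cnj (1 / dom.den z * z powi i) * (1 / cod.den z)) \<odot> \<zeta> l"
    unfolding cod.E_def
    by (intro mul_mul multiplier_cnj dom.multiplier_E cod.multiplier_inverse_den)
  also have "(\<lambda>z. cnj (1 / dom.den z * z powi i) * (1 / cod.den z)) =
      (\<lambda>z. cnj (1 / dom.den z) * (1 / cod.den z) * cnj (z powi i))"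
    by (simp only: complex_cnj_mult mult_ac)
  also have "(\<lambda>z. cnj (1 / dom.den z) * (1 / cod.den z) * cnj (z powi i)) \<odot> \<zeta> l =
      (\<lambda>z. cnj (1 / dom.den z) * (1 / cod.den z)) \<odot> (\<lambda>z. cnj (z powi i)) \<odot> \<zeta> l"
    by (intro mul_mul[symmetric] multiplier_mult multiplier_cnj dom.multiplier_inverse_den
        cod.multiplier_inverse_den multiplier_power_int)
  finally show ?thesis
    by (simp only: mul_cnj_character)
qed

lemma inner_attoeplitz_E:
  assumes "0 \<le> i" "i < int m" "0 \<le> l" "l < int n"
  shows "inner_L2 (attoeplitz dom.B cod.B \<phi> (dom.E i)) (cod.E l) =
    inner_L2 \<phi> ((\<lambda>z. cnj (1 / dom.den z) * (1 / cod.den z)) \<odot> \<zeta> (l - i))"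
  unfolding inner_mult_E[symmetric]
  using assms by (intro attoeplitz_model_space(2) dom.E_in_model_space cod.E_in_model_space)

lemma attoeplitz_Hankel:
  obtains h where "\<And>i j. i < m \<Longrightarrow> j < n \<Longrightarrow>
    inner_L2 (attoeplitz dom.B cod.B \<phi> (dom.E (int i))) (cod.E (int (n - 1 - j))) = h (i + j)"
proof (rule that)
  fix i j assume ij: "i < m" "j < n"
  have "int (n - 1 - j) < int n"
    using ij by linarith
  moreover have "int (n - 1 - j) - int i = int n - 1 - int (i + j)"
    using ij by linarith
  ultimately show "inner_L2 (attoeplitz dom.B cod.B \<phi> (dom.E (int i))) (cod.E (int (n - 1 - j))) =
      (\<lambda>k. inner_L2 \<phi> ((\<lambda>z. cnj (1 / dom.den z) * (1 / cod.den z)) \<odot> \<zeta> (int n - 1 - int k))) (i + j)"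
    using inner_attoeplitz_E[of "int i" "int (n - 1 - j)" \<phi>] ij(1)
    by (simp only: of_nat_0_le_iff of_nat_less_iff simp_thms)
qed

lemma attoeplitz_bounded:
  assumes u: "multiplier u"
  shows "bounded_on (model_space dom.B) (attoeplitz dom.B cod.B (abs_L2 u))"
proof -
  obtain M where M: "\<And>x. norm_L2 (u \<odot> x) \<le> M * norm_L2 x"
    using norm_mul_bound[OF u] by blast
  have "norm_L2 (attoeplitz dom.B cod.B (abs_L2 u) f) \<le> M * norm_L2 f"
    if "f \<in> model_space dom.B" for f
  proof -
    have "norm_L2 (attoeplitz dom.B cod.B (abs_L2 u) f) \<le> norm_L2 (u \<odot> f)"
      using attoeplitz_model_space[OF that] by (intro norm_L2_le_of_inner_eq) simp
    then show ?thesis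
      using M[of f] by linarith
  qed
  then show ?thesis
    unfolding bounded_on_def by blast
qed

text \<open>
  With \<open>V\<close> $= q_\alpha \overline{q_\beta}$ the denominators of the two bases cancel, and the entries of
  the matrix become Fourier coefficients of the Laurent polynomial \<open>p\<close>, which can be prescribed.
  Boundedness of the operator comes from that of the symbol.
\<close>

lemma attoeplitz_Hankel_exists:
  fixes h :: "nat \<Rightarrow> complex"
  obtains \<phi> where "attoeplitz dom.B cod.B \<phi> \<in> attoeplitz_ops dom.B cod.B"
    and "\<And>i j. i < m \<Longrightarrow> j < n \<Longrightarrow>
      inner_L2 (attoeplitz dom.B cod.B \<phi> (dom.E (int i))) (cod.E (int (n - 1 - j))) = h (i + j)"
proof -
  define W where "W = (\<lambda>z. cnj (1 / dom.den z) * (1 / cod.den z))"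
  define V where "V = (\<lambda>z. dom.den z * cnj (cod.den z))"
  define p where "p = (\<lambda>z. \<Sum>k<m + n. h k * z powi (int n - 1 - int k))"
  have W: "multiplier W"
    unfolding W_def
    by (intro multiplier_mult multiplier_cnj dom.multiplier_inverse_den cod.multiplier_inverse_den)
  have V: "multiplier V"
    unfolding V_def by (intro multiplier_mult multiplier_cnj dom.multiplier_den cod.multiplier_den)
  have p: "multiplier p"
    unfolding p_def by (intro multiplier_sum multiplier_mult multiplier_const multiplier_power_int)
  have pk: "inner_L2 (abs_L2 p) (\<zeta> (int n - 1 - int k)) = h k" if "k < m + n" for k
  proof -
    have "abs_L2 p = (\<Sum>k<m + n. h k *\<^sub>L \<zeta> (int n - 1 - int k))"
      unfolding p_def by (rule abs_L2_sum_characters) simp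
    then have "inner_L2 (abs_L2 p) (\<zeta> (int n - 1 - int k)) = (\<Sum>j<m + n. if j = k then h k else 0)"
      by (simp only: inner_sum_left inner_scale_left inner_character) (intro sum.cong, auto)
    then show ?thesis
      using that by simp
  qed
  have Vp: "abs_L2 (\<lambda>z. V z * p z) = V \<odot> abs_L2 p"
    by (intro mul_abs_L2[symmetric] V square_integrable_multiplier p)
  have "(\<lambda>z. cnj (W z)) \<odot> V \<odot> abs_L2 p = abs_L2 p"
  proof -
    have "abs_L2 (\<lambda>z. cnj (W z) * V z) = abs_L2 (\<lambda>z. 1)"
      by (intro abs_L2_cong multiplier_mult multiplier_cnj W V multiplier_const)
        (simp add: W_def V_def dom.den_nonzero cod.den_nonzero)
    then show ?thesis
      by (simp add: mul_mul multiplier_cnj W V)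
  qed
  then have adj: "inner_L2 (V \<odot> abs_L2 p) (W \<odot> x) = inner_L2 (abs_L2 p) x" for x
    using inner_mul_left[OF multiplier_cnj[OF W], of "V \<odot> abs_L2 p" x] by simp
  have "inner_L2 (attoeplitz dom.B cod.B (abs_L2 (\<lambda>z. V z * p z)) (dom.E (int i)))
      (cod.E (int (n - 1 - j))) = h (i + j)" if ij: "i < m" "j < n" for i j
  proof -
    have "int (n - 1 - j) < int n"
      using ij by linarith
    moreover have "int (n - 1 - j) - int i = int n - 1 - int (i + j)"
      using ij by linarith
    ultimately have "inner_L2 (attoeplitz dom.B cod.B (abs_L2 (\<lambda>z. V z * p z)) (dom.E (int i)))
        (cod.E (int (n - 1 - j))) = inner_L2 (V \<odot> abs_L2 p) (W \<odot> \<zeta> (int n - 1 - int (i + j)))"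
      using inner_attoeplitz_E[of "int i" "int (n - 1 - j)" "abs_L2 (\<lambda>z. V z * p z)"] ij(1)
      unfolding Vp W_def by (simp only: of_nat_0_le_iff of_nat_less_iff simp_thms)
    also have "\<dots> = h (i + j)"
      unfolding adj using ij by (intro pk) linarith
    finally show ?thesis .
  qed
  moreover have "attoeplitz dom.B cod.B (abs_L2 (\<lambda>z. V z * p z)) \<in> attoeplitz_ops dom.B cod.B"
    using attoeplitz_bounded[OF multiplier_mult[OF V p]] unfolding attoeplitz_ops_def by blast
  ultimately show ?thesis
    using that by blast
qed

text \<open>
  An operator between the model spaces is determined by its matrix. As the images of the basis vectors
  under the Toeplitz operator are known only through their inner products, linearity in the argument
  is used in the form of \<open>mult_L2_adjoint\<close>.
\<close>

lemma attoeplitz_eq_tensor: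
  assumes q: "q \<in> model_space cod.B"
    and eq: "\<And>i j. i < m \<Longrightarrow> j < n \<Longrightarrow>
      inner_L2 (attoeplitz dom.B cod.B \<phi> (dom.E (int i))) (cod.E (int (n - 1 - j))) =
      r * (inner_L2 (dom.E (int i)) p * inner_L2 q (cod.E (int (n - 1 - j))))"
  shows "attoeplitz dom.B cod.B \<phi> = scaled_op_on (model_space dom.B) r (q \<otimes>\<^sub>L p)"
proof
  fix f
  show "attoeplitz dom.B cod.B \<phi> f = scaled_op_on (model_space dom.B) r (q \<otimes>\<^sub>L p) f"
  proof (cases "f \<in> model_space dom.B")
    case False
    then show ?thesis
      by (simp add: attoeplitz_def scaled_op_on_def)
  next
    case f: True
    have rhs: "scaled_op_on (model_space dom.B) r (q \<otimes>\<^sub>L p) f = (r * inner_L2 f p) *\<^sub>L q"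
      using f by (simp add: scaled_op_on_def tensor_def)
    have "inner_L2 (attoeplitz dom.B cod.B \<phi> f - (r * inner_L2 f p) *\<^sub>L q) (cod.E l) = 0"
      if l: "0 \<le> l" "l < int n" for l
    proof -
      have El: "cod.E l \<in> model_space cod.B"
        using l by (rule cod.E_in_model_space)
      obtain G where G: "\<And>u. multiplier u \<Longrightarrow>
          inner_L2 (mult_L2 \<phi> (abs_L2 u)) (cod.E l) = inner_L2 (abs_L2 u) G"
        using mult_L2_adjoint[OF cod.multiplier_E[of l], of \<phi>] unfolding cod.E_eq_abs_L2 by blast
      have G: "inner_L2 (attoeplitz dom.B cod.B \<phi> g) (cod.E l) = inner_L2 g G"
        if g: "g \<in> model_space dom.B" for g
      proof -
        obtain u where "multiplier u" "g = abs_L2 u"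
          using dom.model_space_multiplier[OF g] by blast
        then show ?thesis
          using G attoeplitz_model_space(2)[OF g El] by simp
      qed
      have idx: "n - 1 - (n - 1 - nat l) = nat l"
        using l by linarith
      have "inner_L2 (dom.E k) G = r * inner_L2 (dom.E k) p * inner_L2 q (cod.E l)"
        if k: "0 \<le> k" "k < int m" for k
      proof -
        have "nat k < m" "n - 1 - nat l < n"
          using k cod.degree_pos by linarith+
        from eq[OF this] show ?thesis
          unfolding idx using k l G[OF dom.E_in_model_space[OF k]] by (simp add: mult.assoc)
      qed
      then have "L2.span (dom.E ` {0..<int m}) \<subseteq>
          {g. inner_L2 g G = r * inner_L2 g p * inner_L2 q (cod.E l)}"
        by (intro L2.span_minimal L2.subspaceI)
          (auto simp: inner_add_left inner_scale_left algebra_simps)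
      then have "inner_L2 f G = r * inner_L2 f p * inner_L2 q (cod.E l)"
        using f unfolding dom.model_space_eq_span by blast
      then show ?thesis
        by (simp add: inner_diff_left inner_scale_left G[OF f])
    qed
    moreover have "attoeplitz dom.B cod.B \<phi> f - (r * inner_L2 f p) *\<^sub>L q \<in> model_space cod.B"
      by (intro L2.subspace_diff[OF subspace_model_space] L2.subspace_scale[OF subspace_model_space]
          attoeplitz_model_space(1) f q)
    ultimately have "attoeplitz dom.B cod.B \<phi> f - (r * inner_L2 f p) *\<^sub>L q = 0"
      by (intro cod.model_space_orthogonal_eq_0)
    then show ?thesis
      by (simp add: rhs)
  qed
qed

end

section \<open>The operators of rank one\<close>

context blaschke_pair
begin

abbreviation rank_one_attoeplitz :: "(L2 \<Rightarrow> L2) set" where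
  "rank_one_attoeplitz \<equiv> {A \<in> attoeplitz_ops dom.B cod.B. rank_on (model_space dom.B) A = 1}"

text \<open>
  A tensor with a Hankel matrix is the Toeplitz operator that realizes this matrix.
\<close>

lemma Hankel_tensor_rank_one:
  assumes p: "p \<in> model_space dom.B" "p \<noteq> 0" and q: "q \<in> model_space cod.B" "q \<noteq> 0" and r: "r \<noteq> 0"
    and Hankel: "\<And>i j. i < m \<Longrightarrow> j < n \<Longrightarrow>
      inner_L2 (dom.E (int i)) p * inner_L2 q (cod.E (int (n - 1 - j))) = h (i + j)"
  shows "scaled_op_on (model_space dom.B) r (q \<otimes>\<^sub>L p) \<in> rank_one_attoeplitz"
proof -
  let ?A = "scaled_op_on (model_space dom.B) r (q \<otimes>\<^sub>L p)"
  obtain \<phi> where \<phi>: "attoeplitz dom.B cod.B \<phi> \<in> attoeplitz_ops dom.B cod.B"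
    "\<And>i j. i < m \<Longrightarrow> j < n \<Longrightarrow>
      inner_L2 (attoeplitz dom.B cod.B \<phi> (dom.E (int i))) (cod.E (int (n - 1 - j))) = r * h (i + j)"
    using attoeplitz_Hankel_exists[of "\<lambda>k. r * h k"] by blast
  have "attoeplitz dom.B cod.B \<phi> = ?A"
    by (rule attoeplitz_eq_tensor[OF q(1)]) (simp only: \<phi>(2) Hankel)
  then have "?A \<in> attoeplitz_ops dom.B cod.B"
    using \<phi>(1) by simp
  moreover have A: "?A f = (r * inner_L2 f p) *\<^sub>L q" if "f \<in> model_space dom.B" for f
    using that by (simp add: scaled_op_on_def tensor_def)
  have "rank_on (model_space dom.B) ?A = 1"
  proof (rule rank_on_eq_1I[OF p(1)])
    show "?A p \<noteq> 0"
      unfolding A[OF p(1)] using p q r by (simp add: inner_self_eq_0_iff)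
    show "\<exists>t. ?A g = t *\<^sub>L q" if "g \<in> model_space dom.B" for g
      using A[OF that] by blast
  qed
  ultimately show ?thesis
    by simp
qed

lemma conj_repr_rank_one:
  assumes w: "norm w \<le> 1" and r: "r \<noteq> 0"
  shows "scaled_op_on (model_space dom.B) r (conj_kernel cod.B w \<otimes>\<^sub>L repr_kernel dom.B w)
    \<in> rank_one_attoeplitz"
proof -
  obtain X where X: "\<And>i. i < m \<Longrightarrow> inner_L2 (dom.E (int i)) (repr_kernel dom.B w) = X * w ^ i"
    using dom.inner_E_repr_kernel[OF w] by blast
  obtain Y where Y: "\<And>j. j < n \<Longrightarrow> inner_L2 (conj_kernel cod.B w) (cod.E (int (n - 1 - j))) = Y * w ^ j"
    using cod.conj_kernel_coefficients[OF w] by blast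
  show ?thesis
  proof (rule Hankel_tensor_rank_one[where h = "\<lambda>k. X * Y * w ^ k"])
    show "inner_L2 (dom.E (int i)) (repr_kernel dom.B w) *
        inner_L2 (conj_kernel cod.B w) (cod.E (int (n - 1 - j))) = X * Y * w ^ (i + j)"
      if "i < m" "j < n" for i j
      unfolding X[OF that(1)] Y[OF that(2)] by (simp add: power_add)
  qed (rule dom.repr_kernel_recurrence[OF w] cod.conj_kernel_recurrence[OF w] r)+
qed

lemma repr_conj_rank_one:
  assumes w: "norm w \<le> 1" and r: "r \<noteq> 0"
  shows "scaled_op_on (model_space dom.B) r (repr_kernel cod.B w \<otimes>\<^sub>L conj_kernel dom.B w)
    \<in> rank_one_attoeplitz"
proof -
  obtain X where X: "\<And>k. k < n \<Longrightarrow> inner_L2 (repr_kernel cod.B w) (cod.E (int k)) = X * cnj w ^ k"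
    using cod.repr_kernel_coefficients[OF w] by blast
  obtain Y where Y: "\<And>i. i < m \<Longrightarrow>
      inner_L2 (dom.E (int i)) (conj_kernel dom.B w) = Y * cnj w ^ (m - 1 - i)"
    using dom.inner_E_conj_kernel[OF w] by blast
  show ?thesis
  proof (rule Hankel_tensor_rank_one[where h = "\<lambda>k. X * Y * cnj w ^ (m + n - 2 - k)"])
    show "inner_L2 (dom.E (int i)) (conj_kernel dom.B w) *
        inner_L2 (repr_kernel cod.B w) (cod.E (int (n - 1 - j))) = X * Y * cnj w ^ (m + n - 2 - (i + j))"
      if ij: "i < m" "j < n" for i j
    proof -
      have "n - 1 - j < n" and "m + n - 2 - (i + j) = (m - 1 - i) + (n - 1 - j)"
        using ij by linarith+
      then show ?thesis
        by (simp only: X Y[OF ij(1)] power_add mult_ac)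
    qed
  qed (rule dom.conj_kernel_recurrence[OF w] cod.repr_kernel_recurrence[OF w] r)+
qed

text \<open>
  If the range is spanned by $v$, the image of $e_i$ is $x_i v$, and the $y_j$ are the inner products
  of $v$ with the reversed second basis. Neither factor vanishes, since otherwise the operator would be zero.
\<close>

lemma rank_one_entries:
  assumes rank: "rank_on (model_space dom.B) (attoeplitz dom.B cod.B \<phi>) = 1"
  obtains x y h where "\<exists>i<m. x i \<noteq> 0" "\<exists>j<n. y j \<noteq> 0"
    and "\<And>i j. i < m \<Longrightarrow> j < n \<Longrightarrow> x i * y j = h (i + j)"
    and "\<And>i j. i < m \<Longrightarrow> j < n \<Longrightarrow>
      inner_L2 (attoeplitz dom.B cod.B \<phi> (dom.E (int i))) (cod.E (int (n - 1 - j))) = x i * y j"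
proof -
  let ?A = "attoeplitz dom.B cod.B \<phi>"
  obtain f where f: "f \<in> model_space dom.B" "?A f \<noteq> 0"
    and range: "\<And>g. g \<in> model_space dom.B \<Longrightarrow> \<exists>t. ?A g = t *\<^sub>L ?A f"
    using rank unfolding rank_on_eq_1_iff by blast
  define y where "y j = inner_L2 (?A f) (cod.E (int (n - 1 - j)))" for j
  have "\<exists>t. ?A (dom.E (int i)) = t *\<^sub>L ?A f" if "i < m" for i
    using that by (intro range dom.E_in_model_space) auto
  then obtain x where x: "\<And>i. i < m \<Longrightarrow> ?A (dom.E (int i)) = x i *\<^sub>L ?A f"
    by metis
  have entry: "inner_L2 (?A (dom.E (int i))) (cod.E (int (n - 1 - j))) = x i * y j" if "i < m" for i j
    unfolding x[OF that] y_def by (rule inner_scale_left)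
  \<comment> \<open>An operator with zero matrix is the zero tensor.\<close>
  have nonzero: "\<not> (\<forall>i<m. \<forall>j<n. x i * y j = 0)"
  proof
    assume zero: "\<forall>i<m. \<forall>j<n. x i * y j = 0"
    have "?A = scaled_op_on (model_space dom.B) 0 (0 \<otimes>\<^sub>L 0)"
    proof (rule attoeplitz_eq_tensor)
      show "0 \<in> model_space cod.B"
        by (rule L2.subspace_0[OF subspace_model_space])
      show "inner_L2 (?A (dom.E (int i))) (cod.E (int (n - 1 - j))) =
          0 * (inner_L2 (dom.E (int i)) 0 * inner_L2 0 (cod.E (int (n - 1 - j))))"
        if ij: "i < m" "j < n" for i j
        unfolding entry[OF ij(1)] using zero ij by simp
    qed
    then have "?A f = 0"
      using f(1) by (simp add: scaled_op_on_def)
    then show False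
      using f(2) by simp
  qed
  obtain h where h: "\<And>i j. i < m \<Longrightarrow> j < n \<Longrightarrow>
      inner_L2 (?A (dom.E (int i))) (cod.E (int (n - 1 - j))) = h (i + j)"
    using attoeplitz_Hankel[of \<phi>] by blast
  show thesis
  proof (rule that)
    show "\<exists>i<m. x i \<noteq> 0" "\<exists>j<n. y j \<noteq> 0"
      using nonzero by auto
    show "x i * y j = h (i + j)" if "i < m" "j < n" for i j
      using h[OF that] entry[OF that(1)] by metis
    show "inner_L2 (?A (dom.E (int i))) (cod.E (int (n - 1 - j))) = x i * y j" if "i < m" "j < n" for i j
      using entry[OF that(1)] .
  qed
qed

text \<open>
  The matrix of the operator is the product of two geometric progressions, and so is the matrix of
  the tensor with the same ratio. The two matrices differ by a nonzero factor, which is the scalar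
  sought for.
\<close>

lemma rank_one_is_kernel_tensor:
  assumes A: "A \<in> rank_one_attoeplitz" and mn: "m * n \<le> 2 \<or> (m > 1 \<and> n > 1)"
  shows "\<exists>r w. r \<noteq> 0 \<and> norm w \<le> 1 \<and>
    (A = scaled_op_on (model_space dom.B) r (conj_kernel cod.B w \<otimes>\<^sub>L repr_kernel dom.B w) \<or>
     A = scaled_op_on (model_space dom.B) r (repr_kernel cod.B w \<otimes>\<^sub>L conj_kernel dom.B w))"
proof -
  obtain \<phi> where \<phi>: "A = attoeplitz dom.B cod.B \<phi>"
    using A unfolding attoeplitz_ops_def by blast
  obtain x y h where nz: "\<exists>i<m. x i \<noteq> 0" "\<exists>j<n. y j \<noteq> 0"
    and Hankel: "\<And>i j. i < m \<Longrightarrow> j < n \<Longrightarrow> x i * y j = h (i + j)"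
    and entry: "\<And>i j. i < m \<Longrightarrow> j < n \<Longrightarrow> 
      inner_L2 (attoeplitz dom.B cod.B \<phi> (dom.E (int i))) (cod.E (int (n - 1 - j))) = x i * y j"
    using rank_one_entries[of \<phi>] A unfolding \<phi> by blast
  show ?thesis
  proof (rule rank_one_Hankel[of m n x y h, OF _ nz mn])
    show "x i * y j = h (i + j)" if "i < m" "j < n" for i j
      by (rule Hankel[OF that])
  next
    fix w s t
    assume disk: "norm w \<le> 1" "s \<noteq> 0" "t \<noteq> 0"
      "\<And>i. i < m \<Longrightarrow> x i = s * w ^ i" "\<And>j. j < n \<Longrightarrow> y j = t * w ^ j"
    obtain X where X: "X \<noteq> 0" "\<And>i. i < m \<Longrightarrow> inner_L2 (dom.E (int i)) (repr_kernel dom.B w) = X * w ^ i"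
      using dom.inner_E_repr_kernel[OF disk(1)] by blast
    obtain Y where Y: "Y \<noteq> 0"
      "\<And>j. j < n \<Longrightarrow> inner_L2 (conj_kernel cod.B w) (cod.E (int (n - 1 - j))) = Y * w ^ j"
      using cod.conj_kernel_coefficients[OF disk(1)] by blast
    have "A = scaled_op_on (model_space dom.B) (s * t / (X * Y)) (conj_kernel cod.B w \<otimes>\<^sub>L repr_kernel dom.B w)"
      unfolding \<phi>
    proof (rule attoeplitz_eq_tensor)
      show "conj_kernel cod.B w \<in> model_space cod.B"
        by (rule cod.conj_kernel_recurrence(1)[OF disk(1)])
      show "inner_L2 (attoeplitz dom.B cod.B \<phi> (dom.E (int i))) (cod.E (int (n - 1 - j))) =
          s * t / (X * Y) * (inner_L2 (dom.E (int i)) (repr_kernel dom.B w) *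
            inner_L2 (conj_kernel cod.B w) (cod.E (int (n - 1 - j))))" if ij: "i < m" "j < n" for i j
        unfolding entry[OF ij] disk(4)[OF ij(1)] disk(5)[OF ij(2)] X(2)[OF ij(1)] Y(2)[OF ij(2)]
        using X(1) Y(1) by simp
    qed
    moreover have "s * t / (X * Y) \<noteq> 0"
      using disk(2,3) X(1) Y(1) by simp
    ultimately show ?thesis
      using disk(1) by blast
  next
    fix w s t
    assume exterior: "norm w \<le> 1" "s \<noteq> 0" "t \<noteq> 0"
      "\<And>i. i < m \<Longrightarrow> x i = s * w ^ (m - 1 - i)"
      "\<And>j. j < n \<Longrightarrow> y j = t * w ^ (n - 1 - j)"
    \<comment> \<open>The matrix of the second family has ratio $\overline{w}$, whence the conjugate parameter.\<close>
    have w: "norm (cnj w) \<le> 1"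
      using exterior(1) by simp
    obtain X where X: "X \<noteq> 0"
      "\<And>k. k < n \<Longrightarrow> inner_L2 (repr_kernel cod.B (cnj w)) (cod.E (int k)) = X * cnj (cnj w) ^ k"
      using cod.repr_kernel_coefficients[OF w] by blast
    obtain Y where Y: "Y \<noteq> 0" "\<And>i. i < m \<Longrightarrow>
        inner_L2 (dom.E (int i)) (conj_kernel dom.B (cnj w)) = Y * cnj (cnj w) ^ (m - 1 - i)"
      using dom.inner_E_conj_kernel[OF w] by blast
    have "A = scaled_op_on (model_space dom.B) (s * t / (X * Y))
        (repr_kernel cod.B (cnj w) \<otimes>\<^sub>L conj_kernel dom.B (cnj w))"
      unfolding \<phi>
    proof (rule attoeplitz_eq_tensor)
      show "repr_kernel cod.B (cnj w) \<in> model_space cod.B"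
        by (rule cod.repr_kernel_recurrence(1)[OF w])
      show "inner_L2 (attoeplitz dom.B cod.B \<phi> (dom.E (int i))) (cod.E (int (n - 1 - j))) =
          s * t / (X * Y) * (inner_L2 (dom.E (int i)) (conj_kernel dom.B (cnj w)) *
            inner_L2 (repr_kernel cod.B (cnj w)) (cod.E (int (n - 1 - j))))" if ij: "i < m" "j < n" for i j
      proof -
        have "n - 1 - j < n"
          using ij by linarith
        then show ?thesis
          unfolding entry[OF ij] exterior(4)[OF ij(1)] exterior(5)[OF ij(2)] Y(2)[OF ij(1)]
            X(2)[OF \<open>n - 1 - j < n\<close>]
          using X(1) Y(1) by simp
      qed
    qed
    moreover have "s * t / (X * Y) \<noteq> 0"
      using exterior(2,3) X(1) Y(1) by simp
    ultimately show ?thesis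
      using w by blast
  qed
qed

text \<open>
  With a single row or a single column every matrix is Hankel, and every nonzero one has rank one. The
  entries $1, 0, 1$ are not consecutive terms of a geometric progression, in either direction.
\<close>

lemma exists_rank_one_not_kernel_tensor:
  assumes mn: "(m = 1 \<and> n > 2) \<or> (n = 1 \<and> m > 2)"
  obtains A where "A \<in> rank_one_attoeplitz"
    and "\<And>r w. norm w \<le> 1 \<Longrightarrow>
      A \<noteq> scaled_op_on (model_space dom.B) r (conj_kernel cod.B w \<otimes>\<^sub>L repr_kernel dom.B w)"
    and "\<And>r w. norm w \<le> 1 \<Longrightarrow>
      A \<noteq> scaled_op_on (model_space dom.B) r (repr_kernel cod.B w \<otimes>\<^sub>L conj_kernel dom.B w)"
proof -
  define h :: "nat \<Rightarrow> complex" where "h k = (if k = 0 \<or> k = 2 then 1 else 0)" for k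
  obtain \<phi> where ops: "attoeplitz dom.B cod.B \<phi> \<in> attoeplitz_ops dom.B cod.B"
    and entry: "\<And>i j. i < m \<Longrightarrow> j < n \<Longrightarrow>
      inner_L2 (attoeplitz dom.B cod.B \<phi> (dom.E (int i))) (cod.E (int (n - 1 - j))) = h (i + j)"
    using attoeplitz_Hankel_exists[of h] by blast
  let ?A = "attoeplitz dom.B cod.B \<phi>"
  have E0: "dom.E 0 \<in> model_space dom.B"
    using dom.degree_pos by (intro dom.E_in_model_space) auto
  have "?A (dom.E 0) \<noteq> 0"
    using entry[of 0 0] dom.degree_pos cod.degree_pos by (auto simp: h_def)
  have "rank_on (model_space dom.B) ?A = 1"
    using mn
  proof
    assume m: "m = 1 \<and> n > 2"
    \<comment> \<open>The scaling gives $\langle e_0, p \rangle = 1$, so that the functional $\langle \cdot, p \rangle$ is the coordinate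
    of the one-dimensional space.\<close>
    define p where "p = (1 / cnj (inner_L2 (dom.E 0) (dom.E 0))) *\<^sub>L dom.E 0"
    have "dom.E 0 \<noteq> 0"
      using dom.inner_E_constant[of 0] by auto
    then have p: "inner_L2 (dom.E 0) p = 1"
      by (simp add: p_def inner_scale_right inner_self_eq_0_iff)
    have A_eq: "?A = scaled_op_on (model_space dom.B) 1 (?A (dom.E 0) \<otimes>\<^sub>L p)"
    proof (rule attoeplitz_eq_tensor)
      show "?A (dom.E 0) \<in> model_space cod.B"
        by (rule attoeplitz_model_space(1)[OF E0])
    qed (use m p in simp)
    have "?A g = inner_L2 g p *\<^sub>L ?A (dom.E 0)" if "g \<in> model_space dom.B" for g
      using that fun_cong[OF A_eq, of g] by (simp add: scaled_op_on_def tensor_def)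
    then show ?thesis
      using E0 \<open>?A (dom.E 0) \<noteq> 0\<close> by (intro rank_on_eq_1I[of "dom.E 0"]) blast+
  next
    assume n: "n = 1 \<and> m > 2"
    have "\<exists>t. ?A g = t *\<^sub>L cod.E 0" if "g \<in> model_space dom.B" for g
    proof -
      have "?A g \<in> L2.span (cod.E ` {0..<int n})"
        using attoeplitz_model_space(1)[OF that] unfolding cod.model_space_eq_span .
      moreover have "{0..<int n} = {0}"
        using n by auto
      ultimately show ?thesis
        by (auto simp: L2.span_singleton)
    qed
    then show ?thesis
      using E0 \<open>?A (dom.E 0) \<noteq> 0\<close> by (intro rank_on_eq_1I[of "dom.E 0"]) blast+
  qed
  then have "?A \<in> rank_one_attoeplitz"
    using ops by simp
  moreover have entries: "\<exists>i j. i < m \<and> j < n \<and> i + j = k" if "k \<le> 2" for k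
    using mn that by (metis add_0 add_0_right le_less_trans less_one)
  have entry_tensor: "h (i + j) = r * (inner_L2 (dom.E (int i)) p * inner_L2 q (cod.E (int (n - 1 - j))))"
    if "?A = scaled_op_on (model_space dom.B) r (q \<otimes>\<^sub>L p)" "i < m" "j < n" for r q p i j
  proof -
    have "dom.E (int i) \<in> model_space dom.B"
      using that(2) by (intro dom.E_in_model_space) auto
    then show ?thesis
      using entry[OF that(2,3)] unfolding that(1)
      by (simp add: scaled_op_on_def tensor_def inner_scale_left mult.assoc)
  qed
  have "?A \<noteq> scaled_op_on (model_space dom.B) r (conj_kernel cod.B w \<otimes>\<^sub>L repr_kernel dom.B w)"
    if w: "norm w \<le> 1" for r w
  proof
    assume eq: "?A = scaled_op_on (model_space dom.B) r (conj_kernel cod.B w \<otimes>\<^sub>L repr_kernel dom.B w)"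
    obtain X where X: "\<And>i. i < m \<Longrightarrow> inner_L2 (dom.E (int i)) (repr_kernel dom.B w) = X * w ^ i"
      using dom.inner_E_repr_kernel[OF w] by blast
    obtain Y where Y: "\<And>j. j < n \<Longrightarrow> inner_L2 (conj_kernel cod.B w) (cod.E (int (n - 1 - j))) = Y * w ^ j"
      using cod.conj_kernel_coefficients[OF w] by blast
    have h: "h k = r * X * Y * w ^ k" if k: "k \<le> 2" for k
    proof -
      obtain i j where "i < m" "j < n" "k = i + j"
        using entries[OF k] by blast
      then show ?thesis
        using entry_tensor[OF eq, of i j] by (simp only: X Y power_add mult_ac)
    qed
    show False
      using h[of 0] h[of 1] h[of 2] by (auto simp: h_def)
  qed
  moreover have "?A \<noteq> scaled_op_on (model_space dom.B) r (repr_kernel cod.B w \<otimes>\<^sub>L conj_kernel dom.B w)"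
    if w: "norm w \<le> 1" for r w
  proof
    assume eq: "?A = scaled_op_on (model_space dom.B) r (repr_kernel cod.B w \<otimes>\<^sub>L conj_kernel dom.B w)"
    obtain X where X: "\<And>k. k < n \<Longrightarrow> inner_L2 (repr_kernel cod.B w) (cod.E (int k)) = X * cnj w ^ k"
      using cod.repr_kernel_coefficients[OF w] by blast
    obtain Y where Y: "\<And>i. i < m \<Longrightarrow>
        inner_L2 (dom.E (int i)) (conj_kernel dom.B w) = Y * cnj w ^ (m - 1 - i)"
      using dom.inner_E_conj_kernel[OF w] by blast
    have h: "h k = r * X * Y * cnj w ^ (m + n - 2 - k)" if k: "k \<le> 2" for k
    proof -
      obtain i j where ij: "i < m" "j < n" "k = i + j"
        using entries[OF k] by blast
      then have "n - 1 - j < n" and "m + n - 2 - k = (m - 1 - i) + (n - 1 - j)"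
        by linarith+
      then show ?thesis
        using ij entry_tensor[OF eq, of i j] by (simp only: X Y power_add mult_ac)
    qed
    have "r * X * Y \<noteq> 0"
      using h[of 2] by (auto simp: h_def)
    moreover have "h 1 = 0" "h 0 = 1"
      by (auto simp: h_def)
    ultimately have "w = 0"
      using h[of 1] by auto
    moreover have "m + n - 2 - 0 \<noteq> 0"
      using mn by auto
    ultimately have "h 0 = 0"
      using h[of 0] by (simp add: power_0_left)
    then show False
      by (simp add: h_def)
  qed
  ultimately show thesis
    using that by blast
qed

lemma rank_one_attoeplitz_eq_kernel_tensors_iff:
  "rank_one_attoeplitz =
      {scaled_op_on (model_space dom.B) r (conj_kernel cod.B w \<otimes>\<^sub>L repr_kernel dom.B w) | r w.
         r \<noteq> 0 \<and> w \<in> cball 0 1} \<union>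
      {scaled_op_on (model_space dom.B) r (repr_kernel cod.B w \<otimes>\<^sub>L conj_kernel dom.B w) | r w.
         r \<noteq> 0 \<and> w \<in> cball 0 1}
    \<longleftrightarrow> m * n \<le> 2 \<or> (m > 1 \<and> n > 1)" (is "_ = ?K \<longleftrightarrow> ?mn")
proof
  assume mn: ?mn
  show "rank_one_attoeplitz = ?K"
  proof
    show "rank_one_attoeplitz \<subseteq> ?K"
    proof
      fix A assume "A \<in> rank_one_attoeplitz"
      from rank_one_is_kernel_tensor[OF this mn] show "A \<in> ?K"
        unfolding mem_cball_0 by blast
    qed
    show "?K \<subseteq> rank_one_attoeplitz"
      using conj_repr_rank_one repr_conj_rank_one unfolding mem_cball_0 by blast
  qed
next
  assume eq: "rank_one_attoeplitz = ?K"
  show ?mn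
  proof (rule ccontr)
    assume "\<not> ?mn"
    then have "(m = 1 \<and> n > 2) \<or> (n = 1 \<and> m > 2)"
      using dom.degree_pos cod.degree_pos by (auto simp: not_less le_Suc_eq not_le)
    then obtain A where "A \<in> rank_one_attoeplitz"
      and not: "\<And>r w. norm w \<le> 1 \<Longrightarrow>
        A \<noteq> scaled_op_on (model_space dom.B) r (conj_kernel cod.B w \<otimes>\<^sub>L repr_kernel dom.B w)"
        "\<And>r w. norm w \<le> 1 \<Longrightarrow>
        A \<noteq> scaled_op_on (model_space dom.B) r (repr_kernel cod.B w \<otimes>\<^sub>L conj_kernel dom.B w)"
      using exists_rank_one_not_kernel_tensor by blast
    then have "A \<in> ?K"
      using eq by blast
    then show False
      using not unfolding mem_cball_0 by blast
  qed
qed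

end

theorem theorem4p5:
  fixes \<alpha> \<beta> :: "complex \<Rightarrow> complex" and m n :: nat
  assumes "finite_Blaschke \<alpha> m" and "m > 0"
    and "finite_Blaschke \<beta> n" and "n > 0"
  shows "{A \<in> attoeplitz_ops \<alpha> \<beta>. rank_on (model_space \<alpha>) A = 1} =
      {scaled_op_on (model_space \<alpha>) c (conj_kernel \<beta> w \<otimes>\<^sub>L repr_kernel \<alpha> w) | c w.
         c \<noteq> 0 \<and> w \<in> cball 0 1} \<union>
      {scaled_op_on (model_space \<alpha>) c (repr_kernel \<beta> w \<otimes>\<^sub>L conj_kernel \<alpha> w) | c w.
         c \<noteq> 0 \<and> w \<in> cball 0 1}
    \<longleftrightarrow> m * n \<le> 2 \<or> (m > 1 \<and> n > 1)"
proof -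
  obtain c a where \<alpha>: "norm c = 1" "\<And>i. i < m \<Longrightarrow> norm (a i) < 1"
    "\<alpha> = (\<lambda>z. c * (\<Prod>i<m. (z - a i) / (1 - cnj (a i) * z)))"
    using assms(1) unfolding finite_Blaschke_def by blast
  obtain d b where \<beta>: "norm d = 1" "\<And>i. i < n \<Longrightarrow> norm (b i) < 1"
    "\<beta> = (\<lambda>z. d * (\<Prod>i<n. (z - b i) / (1 - cnj (b i) * z)))"
    using assms(3) unfolding finite_Blaschke_def by blast
  interpret blaschke_pair c a m d b n
    by unfold_locales (use \<alpha> \<beta> assms in auto)
  have "\<alpha> = dom.B" "\<beta> = cod.B"
    by (auto simp: fun_eq_iff \<alpha>(3) \<beta>(3) dom.B_def cod.B_def dom.num_def cod.num_def
        dom.den_def cod.den_def prod_dividef)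
  then show ?thesis
    by (simp only: rank_one_attoeplitz_eq_kernel_tensors_iff)
qed

end
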